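(* Let $G$ be a nilpotent Lie group whose Lie algebra $\mathfrak g$ is non-Abelian. Then $G$ does not admit any cyclic left-invariant Finsler metric.
   Context: A Minkowski norm on a finite-dimensional real vector space $V$ is a continuous function $F:V\to[0,\infty)$, positive and smooth on $V\setminus\{0\}$, with $F(\lambda y)=\lambda F(y)$ for $\lambda\ge 0$, such that for every $y\neq0$ the fundamental tensor $$\langle u,v\rangle_y=\tfrac12\tfrac{\partial^2}{\partial s\partial t}\Big|_{s=t=0}F^2(y+su+tv)$$ is positive definite. A left-invariant Finsler metric $F$ on a Lie group $G$ is determined by its restriction to $T_eG=\mathfrak g$, which is an arbitrary Minkowski norm on $\mathfrak g$. Such an $F$ is called cyclic (with respect to the reductive decomposition $\mathfrak g=0+\mathfrak g$) if $$\langle[x,y],z\rangle_y+\langle[y,z],x\rangle_y+\langle[z,x],y\rangle_y=0\quad\text{for all } y\in\mathfrak g\setminus\{0\},\ x,z\in\mathfrak g,$$ where $\langle\cdot,\cdot\rangle_y$ is the fundamental tensor of the Minkowski norm on $\mathfrak g$. *)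

theory Defs
  imports
    "HOL-Analysis.Analysis"
    "HOL-Algebra.Generated_Groups"
    "HOL-Library.Function_Algebras"
begin

text \<open>Tangent vectors are functionals on real functions, so they need the pointwise vector space
  structure; \<open>Function_Algebras\<close> supplies the additive part.\<close>

instantiation "fun" :: (type, real_vector) real_vector
begin

definition "scaleR r f = (\<lambda>x. r *\<^sub>R f x)"

instance
  by standard (simp_all add: scaleR_fun_def fun_eq_iff scaleR_add_right scaleR_add_left)

end


section \<open>Smooth functions and smooth manifolds\<close>

text \<open>\<open>S\<close> is always an open set below. For maps between Euclidean spaces this is the usual
  \<open>C\<^sup>k\<close>: all iterated directional derivatives up to order \<open>k\<close> exist and are continuous.\<close>

primrec C_on :: "nat \<Rightarrow> 'a::real_normed_vector set \<Rightarrow> ('a \<Rightarrow> 'b::real_normed_vector) \<Rightarrow> bool" where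
  "C_on 0 S f \<longleftrightarrow> continuous_on S f"
| "C_on (Suc k) S f \<longleftrightarrow> (\<forall>x\<in>S. f differentiable (at x)) \<and>
     (\<forall>v. C_on k S (\<lambda>x. frechet_derivative f (at x) v))"

definition smooth_on :: "'a::real_normed_vector set \<Rightarrow> ('a \<Rightarrow> 'b::real_normed_vector) \<Rightarrow> bool" where
  "smooth_on S f \<longleftrightarrow> (\<forall>k. C_on k S f)"

type_synonym ('g, 'v) chart = "'g set \<times> ('g \<Rightarrow> 'v)"

definition smooth_manifold :: "'g topology \<Rightarrow> ('g, 'v::euclidean_space) chart set \<Rightarrow> bool" where
  "smooth_manifold X A \<longleftrightarrow>
     Hausdorff_space X \<and> second_countable X \<and>
     (\<Union>(U, \<phi>)\<in>A. U) = topspace X \<and>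
     (\<forall>(U, \<phi>)\<in>A. openin X U \<and> open (\<phi> ` U) \<and>
        homeomorphic_map (subtopology X U) (top_of_set (\<phi> ` U)) \<phi>) \<and>
     (\<forall>(U, \<phi>)\<in>A. \<forall>(V, \<psi>)\<in>A. smooth_on (\<phi> ` (U \<inter> V)) (\<psi> \<circ> inv_into U \<phi>))"

definition product_atlas ::
  "('g, 'v) chart set \<Rightarrow> ('h, 'w) chart set \<Rightarrow> ('g \<times> 'h, 'v \<times> 'w) chart set" where
  "product_atlas A B = {(U \<times> V, map_prod \<phi> \<psi>) | U \<phi> V \<psi>. (U, \<phi>) \<in> A \<and> (V, \<psi>) \<in> B}"

definition smooth_map ::
  "'g topology \<Rightarrow> ('g, 'v::euclidean_space) chart set \<Rightarrow>
   'h topology \<Rightarrow> ('h, 'w::euclidean_space) chart set \<Rightarrow> ('g \<Rightarrow> 'h) \<Rightarrow> bool" where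
  "smooth_map X A Y B h \<longleftrightarrow> continuous_map X Y h \<and>
     (\<forall>(U, \<phi>)\<in>A. \<forall>(V, \<psi>)\<in>B.
        smooth_on (\<phi> ` {p \<in> U. h p \<in> V}) (\<psi> \<circ> h \<circ> inv_into U \<phi>))"

definition smooth_near ::
  "'g topology \<Rightarrow> ('g, 'v::euclidean_space) chart set \<Rightarrow> 'g \<Rightarrow> ('g \<Rightarrow> real) \<Rightarrow> bool" where
  "smooth_near X A p f \<longleftrightarrow> (\<exists>W. openin X W \<and> p \<in> W \<and>
     (\<forall>(U, \<phi>)\<in>A. smooth_on (\<phi> ` (U \<inter> W)) (f \<circ> inv_into U \<phi>)))"


section \<open>Tangent vectors and vector fields\<close>

text \<open>A tangent vector at \<open>p\<close> is a functional on the germs at \<open>p\<close> of smooth functions, extended by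
  \<open>0\<close> to functions that are not smooth near \<open>p\<close>. In a chart with coordinates \<open>x\<^sub>i\<close>, the vector
  with components \<open>w\<^sub>i\<close> is the functional \<open>\<Sum>\<^sub>i w\<^sub>i \<partial>/\<partial>x\<^sub>i\<close> at \<open>p\<close>.\<close>

type_synonym 'g tvec = "('g \<Rightarrow> real) \<Rightarrow> real"

definition coord_vec ::
  "'g topology \<Rightarrow> ('g, 'v::euclidean_space) chart set \<Rightarrow> ('g, 'v) chart \<Rightarrow> 'g \<Rightarrow> 'v \<Rightarrow> 'g tvec" where
  "coord_vec X A = (\<lambda>(U, \<phi>) p w f.
     if smooth_near X A p f then frechet_derivative (f \<circ> inv_into U \<phi>) (at (\<phi> p)) w else 0)"

definition tangent_space ::
  "'g topology \<Rightarrow> ('g, 'v::euclidean_space) chart set \<Rightarrow> 'g \<Rightarrow> 'g tvec set" where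
  "tangent_space X A p = {coord_vec X A (U, \<phi>) p w | U \<phi> w. (U, \<phi>) \<in> A \<and> p \<in> U}"

definition push_forward :: "('g \<Rightarrow> 'h) \<Rightarrow> 'g tvec \<Rightarrow> 'h tvec" where
  "push_forward h v = (\<lambda>f. v (f \<circ> h))"

text \<open>The bracket of vector fields, \<open>[\<xi>, \<eta>] f = \<xi> (\<eta> f) - \<eta> (\<xi> f)\<close>.\<close>

definition field_bracket ::
  "'g topology \<Rightarrow> ('g, 'v::euclidean_space) chart set \<Rightarrow>
   ('g \<Rightarrow> 'g tvec) \<Rightarrow> ('g \<Rightarrow> 'g tvec) \<Rightarrow> 'g \<Rightarrow> 'g tvec" where
  "field_bracket X A \<xi> \<eta> p = (\<lambda>f. if smooth_near X A p f
     then \<xi> p (\<lambda>q. \<eta> q f) - \<eta> p (\<lambda>q. \<xi> q f) else 0)"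


section \<open>Lie groups and their Lie algebras\<close>

definition lie_group ::
  "'g topology \<Rightarrow> ('g, 'v::euclidean_space) chart set \<Rightarrow> 'g monoid \<Rightarrow> bool" where
  "lie_group X A G \<longleftrightarrow> group G \<and> smooth_manifold X A \<and> topspace X = carrier G \<and>
     smooth_map (prod_topology X X) (product_atlas A A) X A (\<lambda>(p, q). p \<otimes>\<^bsub>G\<^esub> q) \<and>
     smooth_map X A X A (\<lambda>p. inv\<^bsub>G\<^esub> p)"

text \<open>The Lie algebra is the tangent space at the identity; its bracket is that of the
  left-invariant vector fields extending the two tangent vectors.\<close>

definition lie_algebra ::
  "'g topology \<Rightarrow> ('g, 'v::euclidean_space) chart set \<Rightarrow> 'g monoid \<Rightarrow> 'g tvec set" where
  "lie_algebra X A G = tangent_space X A \<one>\<^bsub>G\<^esub>"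

definition left_invariant_field :: "'g monoid \<Rightarrow> 'g tvec \<Rightarrow> 'g \<Rightarrow> 'g tvec" where
  "left_invariant_field G v p = push_forward (\<lambda>q. p \<otimes>\<^bsub>G\<^esub> q) v"

definition lie_bracket ::
  "'g topology \<Rightarrow> ('g, 'v::euclidean_space) chart set \<Rightarrow> 'g monoid \<Rightarrow>
   'g tvec \<Rightarrow> 'g tvec \<Rightarrow> 'g tvec" where
  "lie_bracket X A G u v =
     field_bracket X A (left_invariant_field G u) (left_invariant_field G v) \<one>\<^bsub>G\<^esub>"

definition nonabelian_lie_algebra ::
  "'g topology \<Rightarrow> ('g, 'v::euclidean_space) chart set \<Rightarrow> 'g monoid \<Rightarrow> bool" where
  "nonabelian_lie_algebra X A G \<longleftrightarrow>
     (\<exists>x\<in>lie_algebra X A G. \<exists>y\<in>lie_algebra X A G. lie_bracket X A G x y \<noteq> 0)"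

primrec lower_central_algebra ::
  "'g topology \<Rightarrow> ('g, 'v::euclidean_space) chart set \<Rightarrow> 'g monoid \<Rightarrow> nat \<Rightarrow> 'g tvec set" where
  "lower_central_algebra X A G 0 = lie_algebra X A G"
| "lower_central_algebra X A G (Suc k) = span {lie_bracket X A G x y | x y.
     x \<in> lie_algebra X A G \<and> y \<in> lower_central_algebra X A G k}"

primrec lower_central_group :: "'g monoid \<Rightarrow> nat \<Rightarrow> 'g set" where
  "lower_central_group G 0 = carrier G"
| "lower_central_group G (Suc k) = generate G {x \<otimes>\<^bsub>G\<^esub> y \<otimes>\<^bsub>G\<^esub> inv\<^bsub>G\<^esub> x \<otimes>\<^bsub>G\<^esub> inv\<^bsub>G\<^esub> y | x y.
     x \<in> carrier G \<and> y \<in> lower_central_group G k}"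

text \<open>Two conventions are in use for a Lie group to be nilpotent: that it is nilpotent as an
  abstract group, or that its Lie algebra is nilpotent. They agree for connected groups; in
  general the first implies the second. Either one is accepted here.\<close>

definition nilpotent_lie_group ::
  "'g topology \<Rightarrow> ('g, 'v::euclidean_space) chart set \<Rightarrow> 'g monoid \<Rightarrow> bool" where
  "nilpotent_lie_group X A G \<longleftrightarrow>
     (\<exists>k. lower_central_group G k = {\<one>\<^bsub>G\<^esub>}) \<or> (\<exists>k. lower_central_algebra X A G k = {0})"


section \<open>Minkowski norms and Finsler metrics\<close>

definition fundamental_tensor ::
  "('t::real_vector \<Rightarrow> real) \<Rightarrow> 't \<Rightarrow> 't \<Rightarrow> 't \<Rightarrow> real" where
  "fundamental_tensor F y u v =
     deriv (\<lambda>s. deriv (\<lambda>t. (F (y + s *\<^sub>R u + t *\<^sub>R v))\<^sup>2) 0) 0 / 2"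

definition minkowski_norm :: "('v::euclidean_space \<Rightarrow> real) \<Rightarrow> bool" where
  "minkowski_norm F \<longleftrightarrow>
     continuous_on UNIV F \<and> (\<forall>y. F y \<ge> 0) \<and>
     (\<forall>y. y \<noteq> 0 \<longrightarrow> F y > 0) \<and> smooth_on (- {0}) F \<and>
     (\<forall>c y. c \<ge> 0 \<longrightarrow> F (c *\<^sub>R y) = c * F y) \<and>
     (\<forall>y u. y \<noteq> 0 \<longrightarrow> u \<noteq> 0 \<longrightarrow> fundamental_tensor F y u u > 0)"

text \<open>A Finsler metric is a continuous function on the tangent bundle, smooth off the zero section,
  whose restriction to each tangent space is a Minkowski norm. A chart identifies each of its
  tangent spaces linearly with the model space and gives bundle coordinates \<open>(x, w)\<close> on the part of
  the tangent bundle over its domain. Values of \<open>F p\<close> outside \<open>tangent_space X A p\<close> are irrelevant.\<close>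

definition finsler_metric ::
  "'g topology \<Rightarrow> ('g, 'v::euclidean_space) chart set \<Rightarrow> ('g \<Rightarrow> 'g tvec \<Rightarrow> real) \<Rightarrow> bool" where
  "finsler_metric X A F \<longleftrightarrow> (\<forall>(U, \<phi>)\<in>A.
     (let F' = (\<lambda>(x, w). F (inv_into U \<phi> x) (coord_vec X A (U, \<phi>) (inv_into U \<phi> x) w)) in
        continuous_on (\<phi> ` U \<times> UNIV) F' \<and> smooth_on (\<phi> ` U \<times> (- {0})) F') \<and>
     (\<forall>p\<in>U. minkowski_norm (\<lambda>w. F p (coord_vec X A (U, \<phi>) p w))))"

definition left_invariant_metric ::
  "'g topology \<Rightarrow> ('g, 'v::euclidean_space) chart set \<Rightarrow> 'g monoid \<Rightarrow>
   ('g \<Rightarrow> 'g tvec \<Rightarrow> real) \<Rightarrow> bool" where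
  "left_invariant_metric X A G F \<longleftrightarrow>
     (\<forall>g\<in>carrier G. \<forall>p\<in>carrier G. \<forall>v\<in>tangent_space X A p.
        F (g \<otimes>\<^bsub>G\<^esub> p) (push_forward (\<lambda>q. g \<otimes>\<^bsub>G\<^esub> q) v) = F p v)"

definition cyclic_metric ::
  "'g topology \<Rightarrow> ('g, 'v::euclidean_space) chart set \<Rightarrow> 'g monoid \<Rightarrow>
   ('g \<Rightarrow> 'g tvec \<Rightarrow> real) \<Rightarrow> bool" where
  "cyclic_metric X A G F \<longleftrightarrow>
     (\<forall>y\<in>lie_algebra X A G - {0}. \<forall>x\<in>lie_algebra X A G. \<forall>z\<in>lie_algebra X A G.
        fundamental_tensor (F \<one>\<^bsub>G\<^esub>) y (lie_bracket X A G x y) z +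
        fundamental_tensor (F \<one>\<^bsub>G\<^esub>) y (lie_bracket X A G y z) x +
        fundamental_tensor (F \<one>\<^bsub>G\<^esub>) y (lie_bracket X A G z x) y = 0)"

end

theory Submission
  imports Defs
begin

text \<open>Why the theorem holds. Let \<open>F\<close> be cyclic and let \<open>y \<noteq> 0\<close> be central in the Lie algebra. Two of
  the three brackets in the cyclic identity at \<open>y\<close> contain \<open>y\<close>, so only
  \<open>\<langle>[z, x], y\<rangle>\<^sub>y = 0\<close> remains: in its own inner product, \<open>y\<close> is orthogonal to every bracket, and hence
  to the derived algebra. A non-abelian nilpotent Lie algebra has such a \<open>y\<close> inside the derived
  algebra, namely in the last non-zero term of the lower central series
  (\<open>nilpotent_central_commutator\<close>). For this \<open>y\<close> the identity gives \<open>\<langle>y, y\<rangle>\<^sub>y = 0\<close>, against positive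
  definiteness. The passage from brackets to their linear span uses the linearity of
  \<open>u \<mapsto> \<langle>u, y\<rangle>\<^sub>y\<close> (\<open>fundamental_tensor_linear\<close>), which holds because \<open>F\<close> is smooth at \<open>y\<close>.

  The bulk of the proof supplies two facts about Lie groups. First, brackets of elements of the Lie
  algebra are again tangent vectors at the identity: in a chart, where multiplication is a smooth
  map \<open>m(x, y)\<close> of Euclidean spaces, the bracket of \<open>u\<close> and \<open>v\<close> has the components
  \<open>B(u, v) - B(v, u)\<close> with \<open>B\<close> the mixed second derivative of \<open>m\<close> at the identity
  (\<open>lie_bracket_Vec\<close>). The second derivatives of the test function cancel, by their symmetry
  (\<open>dir_deriv_commute\<close>).

  Second, if the abstract group is nilpotent, then so is the Lie algebra. Attach to a subgroup \<open>H\<close> the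
  set \<open>T(H)\<close> of velocities at time \<open>0\<close> of curves in \<open>H\<close> through the identity that are
  differentiable at time \<open>0\<close>. Products and rescalings of curves show that \<open>T(H)\<close> is a linear
  subspace, so it is closed. For a curve \<open>c\<close> in \<open>H\<close> with velocity \<open>v\<close> and a fixed group element \<open>a\<close>,
  the curve \<open>a c(t) a\<^sup>-\<^sup>1 c(t)\<^sup>-\<^sup>1\<close> consists of commutators and has the velocity \<open>Ad(a) v - v\<close>. Letting
  \<open>a\<close> tend to the identity in the direction \<open>u\<close> and dividing by the parameter gives the bracket of \<open>u\<close>
  and \<open>v\<close> as a limit of velocities, so it lies in \<open>T\<close> of the commutator group
  (\<open>bracket_velocity\<close>). By induction the lower central series of the algebra is contained in the
  velocities of that of the group, and the trivial group has only the velocity \<open>0\<close>.\<close>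


section \<open>Closure properties of smooth functions\<close>

abbreviation dir_deriv ::
  "('a::real_normed_vector \<Rightarrow> 'b::real_normed_vector) \<Rightarrow> 'a \<Rightarrow> 'a \<Rightarrow> 'b" where
  "dir_deriv f v \<equiv> \<lambda>x. frechet_derivative f (at x) v"

lemma dir_deriv_eqI: "(f has_derivative f') (at x) \<Longrightarrow> dir_deriv f v x = f' v"
  using frechet_derivative_at by metis

lemma frechet_derivative_cong_open:
  assumes "open S" "x \<in> S" "\<And>y. y \<in> S \<Longrightarrow> f y = g y"
  shows "frechet_derivative f (at x) = frechet_derivative g (at x)"
proof -
  have "(f has_derivative f') (at x) \<longleftrightarrow> (g has_derivative f') (at x)" for f'
    using has_derivative_transform_within_open[of f f' x UNIV S g]
      has_derivative_transform_within_open[of g f' x UNIV S f] assms by auto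
  then show ?thesis unfolding frechet_derivative_def by simp
qed

lemma C_on_has_derivative:
  "C_on (Suc k) S f \<Longrightarrow> x \<in> S \<Longrightarrow> (f has_derivative (\<lambda>v. dir_deriv f v x)) (at x)"
  using frechet_derivative_works by auto

lemma C_on_cong:
  assumes "open S" "\<And>x. x \<in> S \<Longrightarrow> f x = g x" "C_on k S f"
  shows "C_on k S g"
  using assms(2,3)
proof (induction k arbitrary: f g)
  case 0
  then show ?case using continuous_on_cong[OF refl, of S f g] by simp
next
  case (Suc k)
  have "g differentiable (at x)" if "x \<in> S" for x
    using has_derivative_transform_within_open[OF C_on_has_derivative[OF Suc.prems(2) that] assms(1) that]
      Suc.prems(1) unfolding differentiable_def by blast
  moreover have "C_on k S (dir_deriv g v)" for v
  proof (rule Suc.IH)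
    show "dir_deriv f v x = dir_deriv g v x" if "x \<in> S" for x
      using frechet_derivative_cong_open[OF assms(1) that Suc.prems(1)] by simp
  qed (use Suc.prems in simp)
  ultimately show ?case by simp
qed

lemma C_on_subset: "C_on k S f \<Longrightarrow> T \<subseteq> S \<Longrightarrow> C_on k T f"
  by (induction k arbitrary: f) (auto intro: continuous_on_subset)

lemma C_on_imp_continuous_on: "C_on k S f \<Longrightarrow> continuous_on S f"
  by (cases k) (simp_all add: continuous_at_imp_continuous_on differentiable_imp_continuous_within)

lemma C_on_Suc_imp_C_on: "C_on (Suc k) S f \<Longrightarrow> C_on k S f"
proof (induction k arbitrary: f)
  case 0
  then show ?case using C_on_imp_continuous_on by fastforce
next
  case (Suc k)
  then show ?case by (metis C_on.simps(2))
qed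

lemma C_on_const: "C_on k S (\<lambda>x. c)"
  by (induction k arbitrary: c) auto

lemma C_on_bounded_linear:
  assumes "bounded_linear L"
  shows "C_on k S L"
proof (cases k)
  case 0
  then show ?thesis using assms by (simp add: linear_continuous_on)
next
  case (Suc n)
  have "frechet_derivative L (at x) = L" for x
    using bounded_linear_imp_has_derivative[OF assms] frechet_derivative_at by metis
  then show ?thesis
    using Suc assms by (auto simp: C_on_const bounded_linear_imp_differentiable)
qed

lemma C_on_add:
  assumes "open S" "C_on k S f" "C_on k S g"
  shows "C_on k S (\<lambda>x. f x + g x)"
  using assms(2,3)
proof (induction k arbitrary: f g)
  case 0
  then show ?case by (auto intro: continuous_on_add)
next
  case (Suc k)
  have *: "((\<lambda>x. f x + g x) has_derivative (\<lambda>v. dir_deriv f v x + dir_deriv g v x)) (at x)"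
    if "x \<in> S" for x
    using Suc.prems that by (intro has_derivative_add C_on_has_derivative)
  have "C_on k S (dir_deriv (\<lambda>x. f x + g x) v)" for v
  proof (rule C_on_cong[OF assms(1)])
    show "C_on k S (\<lambda>x. dir_deriv f v x + dir_deriv g v x)"
      using Suc by simp
  qed (use dir_deriv_eqI[OF *] in simp)
  with * show ?case by (auto simp: differentiable_def)
qed

lemma C_on_sum:
  assumes "open S" "finite I" "\<And>i. i \<in> I \<Longrightarrow> C_on k S (f i)"
  shows "C_on k S (\<lambda>x. \<Sum>i\<in>I. f i x)"
  using assms(2,3) by (induction I) (auto simp: C_on_const intro: C_on_add[OF assms(1)])

lemma C_on_scaleR:
  fixes a :: "'a::real_normed_vector \<Rightarrow> real"
  assumes "open S" "C_on k S a" "C_on k S g"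
  shows "C_on k S (\<lambda>x. a x *\<^sub>R g x)"
  using assms(2,3)
proof (induction k arbitrary: a g)
  case 0
  then show ?case by (auto intro: continuous_on_scaleR)
next
  case (Suc k)
  have *: "((\<lambda>x. a x *\<^sub>R g x) has_derivative (\<lambda>v. a x *\<^sub>R dir_deriv g v x + dir_deriv a v x *\<^sub>R g x)) (at x)"
    if "x \<in> S" for x
    using Suc.prems that by (intro has_derivative_scaleR C_on_has_derivative)
  have "C_on k S (dir_deriv (\<lambda>x. a x *\<^sub>R g x) v)" for v
  proof (rule C_on_cong[OF assms(1)])
    show "C_on k S (\<lambda>x. a x *\<^sub>R dir_deriv g v x + dir_deriv a v x *\<^sub>R g x)"
      using Suc by (intro C_on_add assms(1) Suc.IH) (auto intro: C_on_Suc_imp_C_on)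
  qed (use dir_deriv_eqI[OF *] in simp)
  with * show ?case by (auto simp: differentiable_def)
qed

lemma C_on_bounded_linear_compose:
  assumes "open S" "bounded_linear L" "C_on k S f"
  shows "C_on k S (\<lambda>x. L (f x))"
  using assms(3)
proof (induction k arbitrary: f)
  case 0
  then show ?case using assms(2) by (auto intro: bounded_linear.continuous_on)
next
  case (Suc k)
  have *: "((\<lambda>x. L (f x)) has_derivative (\<lambda>v. L (dir_deriv f v x))) (at x)"
    if "x \<in> S" for x
    using Suc.prems that by (intro bounded_linear.has_derivative[OF assms(2)] C_on_has_derivative)
  have "C_on k S (dir_deriv (\<lambda>x. L (f x)) v)" for v
    by (rule C_on_cong[OF assms(1), of "\<lambda>x. L (dir_deriv f v x)"])
      (use dir_deriv_eqI[OF *] Suc in auto)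
  with * show ?case by (auto simp: differentiable_def)
qed

text \<open>The coordinate expansion turns a derivative in a direction that varies with the point, as it arises
  in the chain rule, into a sum of products of functions of the point.\<close>

lemma frechet_derivative_euclidean_sum:
  fixes g :: "'a::euclidean_space \<Rightarrow> 'b::real_normed_vector"
  assumes "g differentiable (at y)"
  shows "dir_deriv g v y = (\<Sum>i\<in>Basis. (v \<bullet> i) *\<^sub>R dir_deriv g i y)"
proof -
  have l: "linear (frechet_derivative g (at y))"
    using assms linear_frechet_derivative by blast
  have "dir_deriv g v y = frechet_derivative g (at y) (\<Sum>i\<in>Basis. (v \<bullet> i) *\<^sub>R i)"
    by (simp add: euclidean_representation)
  also have "\<dots> = (\<Sum>i\<in>Basis. (v \<bullet> i) *\<^sub>R dir_deriv g i y)"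
    by (simp add: linear_sum[OF l] linear_scale[OF l])
  finally show ?thesis .
qed

lemma C_on_compose:
  fixes f :: "'a::real_normed_vector \<Rightarrow> 'b::euclidean_space"
    and g :: "'b \<Rightarrow> 'c::real_normed_vector"
  assumes "open S" "open T" "f ` S \<subseteq> T" "C_on k S f" "C_on k T g"
  shows "C_on k S (\<lambda>x. g (f x))"
  using assms(4,5)
proof (induction k arbitrary: g)
  case 0
  then show ?case
    using assms(3) by (simp add: continuous_on_compose2)
next
  case (Suc k)
  have *: "((\<lambda>x. g (f x)) has_derivative (\<lambda>v. dir_deriv g (dir_deriv f v x) (f x))) (at x)"
    if "x \<in> S" for x
    using assms(3) that
    by (intro has_derivative_compose[OF C_on_has_derivative[OF Suc.prems(1)]]
        C_on_has_derivative[OF Suc.prems(2)]) auto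
  have "C_on k S (dir_deriv (\<lambda>x. g (f x)) v)" for v
  proof (rule C_on_cong[OF assms(1)])
    show "C_on k S (\<lambda>x. \<Sum>i\<in>Basis. (dir_deriv f v x \<bullet> i) *\<^sub>R dir_deriv g i (f x))"
    proof (intro C_on_sum C_on_scaleR assms(1) finite_Basis)
      show "C_on k S (\<lambda>x. dir_deriv f v x \<bullet> i)" for i
        using Suc.prems by (intro C_on_bounded_linear_compose[OF assms(1) bounded_linear_inner_left]) simp
      show "C_on k S (\<lambda>x. dir_deriv g i (f x))" for i
        using Suc.prems C_on_Suc_imp_C_on[OF Suc.prems(1)] by (intro Suc.IH) auto
    qed
    show "(\<Sum>i\<in>Basis. (dir_deriv f v x \<bullet> i) *\<^sub>R dir_deriv g i (f x)) = dir_deriv (\<lambda>x. g (f x)) v x"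
      if "x \<in> S" for x
      using dir_deriv_eqI[OF *[OF that]] Suc.prems that assms(3)
      by (subst frechet_derivative_euclidean_sum[symmetric]) auto
  qed
  with * show ?case by (auto simp: differentiable_def)
qed

lemma C_on_Pair:
  assumes "open S" "C_on k S f" "C_on k S g"
  shows "C_on k S (\<lambda>x. (f x, g x))"
proof -
  have inl: "bounded_linear (\<lambda>y::'b. (y, 0::'c))" and inr: "bounded_linear (\<lambda>y::'c. (0::'b, y))"
    by (intro bounded_linear_Pair bounded_linear_ident bounded_linear_zero)+
  have "C_on k S (\<lambda>x. (f x, 0) + (0, g x))"
    by (rule C_on_add[OF assms(1) C_on_bounded_linear_compose[OF assms(1) inl assms(2)]
          C_on_bounded_linear_compose[OF assms(1) inr assms(3)]])
  then show ?thesis by simp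
qed

lemma smooth_on_imp_differentiable: "smooth_on S f \<Longrightarrow> x \<in> S \<Longrightarrow> f differentiable (at x)"
  unfolding smooth_on_def using C_on.simps(2)[of 0 S f] by blast

lemma smooth_on_has_derivative:
  "smooth_on S f \<Longrightarrow> x \<in> S \<Longrightarrow> (f has_derivative (\<lambda>v. dir_deriv f v x)) (at x)"
  unfolding smooth_on_def using C_on_has_derivative by blast

lemma smooth_on_dir_deriv: "smooth_on S f \<Longrightarrow> smooth_on S (dir_deriv f v)"
  unfolding smooth_on_def using C_on.simps(2)[of _ S f] by blast

lemma smooth_on_cong:
  "open S \<Longrightarrow> (\<And>x. x \<in> S \<Longrightarrow> f x = g x) \<Longrightarrow> smooth_on S f \<Longrightarrow> smooth_on S g"
  unfolding smooth_on_def using C_on_cong by blast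

lemma smooth_on_subset: "smooth_on S f \<Longrightarrow> T \<subseteq> S \<Longrightarrow> smooth_on T f"
  unfolding smooth_on_def using C_on_subset by blast

lemma smooth_on_compose:
  fixes f :: "'a::real_normed_vector \<Rightarrow> 'b::euclidean_space"
  assumes "open S" "open T" "f ` S \<subseteq> T" "smooth_on S f" "smooth_on T g"
  shows "smooth_on S (\<lambda>x. g (f x))"
  using assms C_on_compose unfolding smooth_on_def by blast

lemma smooth_on_Pair:
  "open S \<Longrightarrow> smooth_on S f \<Longrightarrow> smooth_on S g \<Longrightarrow> smooth_on S (\<lambda>x. (f x, g x))"
  unfolding smooth_on_def using C_on_Pair by blast

lemma smooth_on_const: "smooth_on S (\<lambda>x. c)"
  unfolding smooth_on_def using C_on_const by blast

lemma smooth_on_ident: "smooth_on S (\<lambda>x. x)"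
  unfolding smooth_on_def using C_on_bounded_linear[OF bounded_linear_ident] by blast

lemma smooth_on_mult:
  fixes f g :: "'a::real_normed_vector \<Rightarrow> real"
  shows "open S \<Longrightarrow> smooth_on S f \<Longrightarrow> smooth_on S g \<Longrightarrow> smooth_on S (\<lambda>x. f x * g x)"
  unfolding smooth_on_def using C_on_scaleR[of S _ f g] by simp


section \<open>Second derivatives and limits\<close>

text \<open>The mean value theorem in the direction \<open>u\<close>, applied to the increment of \<open>f\<close> along \<open>v\<close>, and
  then once more in the direction \<open>v\<close>.\<close>

lemma second_difference_mvt:
  fixes f :: "'a::real_normed_vector \<Rightarrow> real"
  assumes "C_on 2 S f" "h > 0"
    and box: "\<And>s t. 0 \<le> s \<Longrightarrow> s \<le> h \<Longrightarrow> 0 \<le> t \<Longrightarrow> t \<le> h \<Longrightarrow> x + s *\<^sub>R u + t *\<^sub>R v \<in> S"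
  obtains s t where "0 < s" "s < h" "0 < t" "t < h"
    "f (x + h *\<^sub>R u + h *\<^sub>R v) - f (x + h *\<^sub>R u) - f (x + h *\<^sub>R v) + f x
       = h * h * dir_deriv (dir_deriv f u) v (x + s *\<^sub>R u + t *\<^sub>R v)"
proof -
  have D1: "f differentiable (at y)" and D2: "dir_deriv f u differentiable (at y)" if "y \<in> S" for y
    using assms(1) that by (auto simp: numeral_2_eq_2)
  have d1: "((\<lambda>s. f (x + s *\<^sub>R u + t *\<^sub>R v)) has_real_derivative dir_deriv f u (x + s *\<^sub>R u + t *\<^sub>R v)) (at s)"
    if "0 \<le> s" "s \<le> h" "0 \<le> t" "t \<le> h" for s t
  proof -
    have "((\<lambda>s. x + s *\<^sub>R u + t *\<^sub>R v) has_derivative (\<lambda>r. r *\<^sub>R u)) (at s)"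
      by (auto intro!: derivative_eq_intros)
    from has_derivative_compose[OF this frechet_derivative_works[THEN iffD1, OF D1]] box that
    have "((\<lambda>s. f (x + s *\<^sub>R u + t *\<^sub>R v)) has_derivative
       (\<lambda>r. dir_deriv f (r *\<^sub>R u) (x + s *\<^sub>R u + t *\<^sub>R v))) (at s)" by auto
    moreover have "dir_deriv f (r *\<^sub>R u) (x + s *\<^sub>R u + t *\<^sub>R v) = dir_deriv f u (x + s *\<^sub>R u + t *\<^sub>R v) * r" for r
      using linear_scale[OF linear_frechet_derivative[OF D1]] box that by simp
    ultimately show ?thesis by (simp add: has_field_derivative_def)
  qed
  have d2: "((\<lambda>t. dir_deriv f u (x + s *\<^sub>R u + t *\<^sub>R v)) has_real_derivative dir_deriv (dir_deriv f u) v (x + s *\<^sub>R u + t *\<^sub>R v)) (at t)"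
    if "0 \<le> s" "s \<le> h" "0 \<le> t" "t \<le> h" for s t
  proof -
    have "((\<lambda>t. x + s *\<^sub>R u + t *\<^sub>R v) has_derivative (\<lambda>r. r *\<^sub>R v)) (at t)"
      by (auto intro!: derivative_eq_intros)
    from has_derivative_compose[OF this frechet_derivative_works[THEN iffD1, OF D2]] box that
    have "((\<lambda>t. dir_deriv f u (x + s *\<^sub>R u + t *\<^sub>R v)) has_derivative
       (\<lambda>r. dir_deriv (dir_deriv f u) (r *\<^sub>R v) (x + s *\<^sub>R u + t *\<^sub>R v))) (at t)" by auto
    moreover have "dir_deriv (dir_deriv f u) (r *\<^sub>R v) (x + s *\<^sub>R u + t *\<^sub>R v) = dir_deriv (dir_deriv f u) v (x + s *\<^sub>R u + t *\<^sub>R v) * r" for r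
      using linear_scale[OF linear_frechet_derivative[OF D2]] box that by simp
    ultimately show ?thesis by (simp add: has_field_derivative_def)
  qed
  define \<phi> where "\<phi> s = f (x + s *\<^sub>R u + h *\<^sub>R v) - f (x + s *\<^sub>R u + 0 *\<^sub>R v)" for s
  have "(\<phi> has_real_derivative
      dir_deriv f u (x + s *\<^sub>R u + h *\<^sub>R v) - dir_deriv f u (x + s *\<^sub>R u + 0 *\<^sub>R v)) (at s)"
    if "0 \<le> s" "s \<le> h" for s
    unfolding \<phi>_def using that assms(2) by (intro DERIV_diff d1) auto
  from MVT2[OF assms(2) this] obtain s where s: "0 < s" "s < h"
    "\<phi> h - \<phi> 0 = (h - 0) * (dir_deriv f u (x + s *\<^sub>R u + h *\<^sub>R v) - dir_deriv f u (x + s *\<^sub>R u + 0 *\<^sub>R v))"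
    by auto
  from MVT2[OF assms(2) d2[of s]] s obtain t where t: "0 < t" "t < h"
    "dir_deriv f u (x + s *\<^sub>R u + h *\<^sub>R v) - dir_deriv f u (x + s *\<^sub>R u + 0 *\<^sub>R v)
      = (h - 0) * dir_deriv (dir_deriv f u) v (x + s *\<^sub>R u + t *\<^sub>R v)"
    by force
  show ?thesis
    by (rule that[OF s(1,2) t(1,2)]) (use s(3) t(3) in \<open>simp add: \<phi>_def\<close>)
qed

lemma second_difference_tendsto:
  fixes f :: "'a::real_normed_vector \<Rightarrow> real"
  assumes "open S" "C_on 2 S f" "x \<in> S"
  shows "((\<lambda>h. (f (x + h *\<^sub>R u + h *\<^sub>R v) - f (x + h *\<^sub>R u) - f (x + h *\<^sub>R v) + f x) / (h * h))
           \<longlongrightarrow> dir_deriv (dir_deriv f u) v x) (at_right 0)"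
proof (rule tendstoI)
  fix e :: real assume "e > 0"
  let ?H = "dir_deriv (dir_deriv f u) v"
  have "continuous_on S ?H" using assms(2) by (simp add: numeral_2_eq_2)
  then have "isCont ?H x" using assms by (simp add: continuous_on_eq_continuous_at)
  then obtain d1 where d1: "d1 > 0" "\<And>y. dist y x < d1 \<Longrightarrow> dist (?H y) (?H x) < e"
    using \<open>e > 0\<close> unfolding continuous_at_eps_delta by blast
  obtain d2 where d2: "d2 > 0" "ball x d2 \<subseteq> S" using assms open_contains_ball by blast
  \<comment> \<open>The summand \<open>1\<close> keeps the denominator positive when both directions vanish.\<close>
  define d where "d = min d1 d2 / (norm u + norm v + 1)"
  have pos: "norm u + norm v + 1 > 0" by (smt (verit) norm_ge_zero)
  have "d > 0" using d1 d2 pos by (simp add: d_def)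
  have near: "dist (x + s *\<^sub>R u + t *\<^sub>R v) x < min d1 d2"
    if "h < d" "0 < h" "0 \<le> s" "s \<le> h" "0 \<le> t" "t \<le> h" for h s t
  proof -
    have "dist (x + s *\<^sub>R u + t *\<^sub>R v) x \<le> s * norm u + t * norm v"
      using norm_triangle_ineq[of "s *\<^sub>R u" "t *\<^sub>R v"] that by (simp add: dist_norm add.assoc)
    also have "\<dots> \<le> h * norm u + h * norm v" using that by (intro add_mono mult_right_mono) auto
    also have "\<dots> < h * (norm u + norm v + 1)" using that by (simp add: algebra_simps)
    also have "\<dots> < min d1 d2" using that pos by (simp add: d_def field_simps)
    finally show ?thesis .
  qed
  have "dist ((f (x + h *\<^sub>R u + h *\<^sub>R v) - f (x + h *\<^sub>R u) - f (x + h *\<^sub>R v) + f x) / (h * h)) (?H x) < e"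
    if h: "0 < h" "h < d" for h
  proof -
    have "x + s *\<^sub>R u + t *\<^sub>R v \<in> S" if "0 \<le> s" "s \<le> h" "0 \<le> t" "t \<le> h" for s t
      using near[OF h(2,1) that] d2 by (auto simp: dist_commute subset_iff)
    from second_difference_mvt[OF assms(2) h(1) this]
    obtain s t where st: "0 < s" "s < h" "0 < t" "t < h"
      "f (x + h *\<^sub>R u + h *\<^sub>R v) - f (x + h *\<^sub>R u) - f (x + h *\<^sub>R v) + f x
       = h * h * ?H (x + s *\<^sub>R u + t *\<^sub>R v)" by blast
    show ?thesis using st h d1(2)[of "x + s *\<^sub>R u + t *\<^sub>R v"] near[OF h(2,1), of s t] by simp
  qed
  then show "\<forall>\<^sub>F h in at_right 0. dist ((f (x + h *\<^sub>R u + h *\<^sub>R v) - f (x + h *\<^sub>R u) - f (x + h *\<^sub>R v) + f x) / (h * h)) (?H x) < e"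
    unfolding eventually_at_right_field using \<open>d > 0\<close> by auto
qed

text \<open>The second difference quotient is symmetric in the two directions, and by continuity of the second
  derivatives it tends to either of the iterated derivatives, depending on which direction is
  treated first. Vector-valued functions are handled by components.\<close>

lemma dir_deriv_commute:
  fixes f :: "'a::real_normed_vector \<Rightarrow> 'b::euclidean_space"
  assumes "open S" "C_on 2 S f" "x \<in> S"
  shows "dir_deriv (dir_deriv f u) v x = dir_deriv (dir_deriv f v) u x"
proof (rule euclidean_eqI)
  fix i :: 'b assume "i \<in> Basis"
  define g where "g y = f y \<bullet> i" for y
  have g: "C_on 2 S g"
    unfolding g_def by (rule C_on_bounded_linear_compose[OF assms(1) bounded_linear_inner_left assms(2)])
  have d1: "dir_deriv g w y = dir_deriv f w y \<bullet> i" if "y \<in> S" for w y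
  proof -
    have "(f has_derivative (\<lambda>w. dir_deriv f w y)) (at y)"
      using C_on_has_derivative assms(2) that unfolding numeral_2_eq_2 by blast
    from dir_deriv_eqI[OF has_derivative_inner_left[OF this]] show ?thesis
      unfolding g_def .
  qed
  have d2: "dir_deriv (dir_deriv g w) z x = dir_deriv (dir_deriv f w) z x \<bullet> i" for w z
  proof -
    have "dir_deriv (dir_deriv g w) z x = dir_deriv (\<lambda>y. dir_deriv f w y \<bullet> i) z x"
      by (simp only: frechet_derivative_cong_open[OF assms(1,3) d1])
    moreover have "(dir_deriv f w has_derivative (\<lambda>z. dir_deriv (dir_deriv f w) z x)) (at x)"
      using C_on_has_derivative[of 0 S "dir_deriv f w"] assms(2,3) by (simp add: numeral_2_eq_2)
    ultimately show ?thesis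
      using dir_deriv_eqI[OF has_derivative_inner_left] by simp
  qed
  define \<Delta> where
    "\<Delta> u v h = (g (x + h *\<^sub>R u + h *\<^sub>R v) - g (x + h *\<^sub>R u) - g (x + h *\<^sub>R v) + g x) / (h * h)" for u v h
  have lim: "(\<Delta> u v \<longlongrightarrow> dir_deriv (dir_deriv g u) v x) (at_right 0)" for u v
    unfolding \<Delta>_def by (rule second_difference_tendsto[OF assms(1) g assms(3)])
  have "\<Delta> v u h = \<Delta> u v h" for h
    by (simp add: \<Delta>_def add_ac)
  then have "\<Delta> v u = \<Delta> u v" by (rule ext)
  then have "dir_deriv (dir_deriv g u) v x = dir_deriv (dir_deriv g v) u x"
    using tendsto_unique[OF trivial_limit_at_right_real lim[of u v]] lim[of v u] by simp
  then show "dir_deriv (dir_deriv f u) v x \<bullet> i = dir_deriv (dir_deriv f v) u x \<bullet> i"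
    by (simp add: d2)
qed

text \<open>The product rule for a directional derivative whose direction \<open>\<xi>\<close> depends on the point.\<close>

lemma dir_deriv_along_field:
  fixes f :: "'a::euclidean_space \<Rightarrow> 'b::real_normed_vector" and \<xi> :: "'a \<Rightarrow> 'a"
  assumes S: "open S" "x \<in> S" and f: "smooth_on S f"
    and \<xi>: "(\<xi> has_derivative \<xi>') (at x)"
  shows "dir_deriv (\<lambda>y. dir_deriv f (\<xi> y) y) u x
    = dir_deriv (dir_deriv f (\<xi> x)) u x + dir_deriv f (\<xi>' u) x"
proof -
  have expand: "dir_deriv f w y = (\<Sum>i\<in>Basis. (w \<bullet> i) *\<^sub>R dir_deriv f i y)" if "y \<in> S" for w y
    using frechet_derivative_euclidean_sum smooth_on_imp_differentiable[OF f that] by blast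
  have D: "(dir_deriv f i has_derivative (\<lambda>u. dir_deriv (dir_deriv f i) u x)) (at x)" for i
    using smooth_on_has_derivative[OF smooth_on_dir_deriv[OF f] S(2)] .
  have "((\<lambda>y. \<Sum>i\<in>Basis. (\<xi> y \<bullet> i) *\<^sub>R dir_deriv f i y) has_derivative
      (\<lambda>u. \<Sum>i\<in>Basis. (\<xi> x \<bullet> i) *\<^sub>R dir_deriv (dir_deriv f i) u x + (\<xi>' u \<bullet> i) *\<^sub>R dir_deriv f i x)) (at x)"
    by (intro has_derivative_sum has_derivative_scaleR has_derivative_inner_left \<xi> D)
  from dir_deriv_eqI[OF this]
  have 1: "dir_deriv (\<lambda>y. dir_deriv f (\<xi> y) y) u x =
      (\<Sum>i\<in>Basis. (\<xi> x \<bullet> i) *\<^sub>R dir_deriv (dir_deriv f i) u x) + (\<Sum>i\<in>Basis. (\<xi>' u \<bullet> i) *\<^sub>R dir_deriv f i x)"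
    using frechet_derivative_cong_open[OF S, of "\<lambda>y. dir_deriv f (\<xi> y) y" "\<lambda>y. \<Sum>i\<in>Basis. (\<xi> y \<bullet> i) *\<^sub>R dir_deriv f i y"]
      expand by (simp add: sum.distrib)
  have "((\<lambda>y. \<Sum>i\<in>Basis. (\<xi> x \<bullet> i) *\<^sub>R dir_deriv f i y) has_derivative
      (\<lambda>u. \<Sum>i\<in>Basis. (\<xi> x \<bullet> i) *\<^sub>R dir_deriv (dir_deriv f i) u x)) (at x)"
    by (intro has_derivative_sum has_derivative_scaleR_right D)
  from dir_deriv_eqI[OF this]
  have 2: "dir_deriv (dir_deriv f (\<xi> x)) u x = (\<Sum>i\<in>Basis. (\<xi> x \<bullet> i) *\<^sub>R dir_deriv (dir_deriv f i) u x)"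
    using frechet_derivative_cong_open[OF S, of "dir_deriv f (\<xi> x)" "\<lambda>y. \<Sum>i\<in>Basis. (\<xi> x \<bullet> i) *\<^sub>R dir_deriv f i y"]
      expand by simp
  show ?thesis unfolding 1 2 expand[OF S(2), of "\<xi>' u"] ..
qed

text \<open>If the operators \<open>T s\<close> tend to the identity, then \<open>k s\<close> and \<open>T s (k s)\<close> have the same limit.
  The point is that \<open>k\<close> is not known to be bounded beforehand; once \<open>T s\<close> is within distance \<open>1/2\<close> of
  the identity, \<open>k s\<close> is bounded by twice the convergent \<open>T s (k s)\<close>.\<close>

lemma tendsto_of_near_identity:
  fixes k :: "'a \<Rightarrow> 'v::euclidean_space"
  assumes "\<And>s. linear (T s)" and T: "\<And>i. i \<in> Basis \<Longrightarrow> ((\<lambda>s. T s i) \<longlongrightarrow> i) F"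
    and lim: "((\<lambda>s. T s (k s)) \<longlongrightarrow> b) F"
  shows "(k \<longlongrightarrow> b) F"
proof -
  define \<epsilon> where "\<epsilon> s = (\<Sum>i\<in>Basis. norm (T s i - i))" for s
  have "(\<epsilon> \<longlongrightarrow> (\<Sum>i\<in>(Basis::'v set). norm (i - i))) F"
    unfolding \<epsilon>_def by (intro tendsto_sum tendsto_norm tendsto_diff T tendsto_const)
  then have \<epsilon>: "(\<epsilon> \<longlongrightarrow> 0) F" by simp
  have dev: "norm (T s w - w) \<le> \<epsilon> s * norm w" for s w
  proof -
    have "T s w = T s (\<Sum>i\<in>Basis. (w \<bullet> i) *\<^sub>R i)" by (simp add: euclidean_representation)
    also have "\<dots> = (\<Sum>i\<in>Basis. (w \<bullet> i) *\<^sub>R T s i)"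
      by (simp add: linear_sum[OF assms(1)] linear_scale[OF assms(1)])
    finally have "T s w - w = (\<Sum>i\<in>Basis. (w \<bullet> i) *\<^sub>R T s i) - (\<Sum>i\<in>Basis. (w \<bullet> i) *\<^sub>R i)"
      by (simp add: euclidean_representation)
    also have "\<dots> = (\<Sum>i\<in>Basis. (w \<bullet> i) *\<^sub>R (T s i - i))"
      by (simp add: scaleR_diff_right sum_subtractf)
    also have "norm \<dots> \<le> (\<Sum>i\<in>Basis. norm w * norm (T s i - i))"
      by (intro sum_norm_le) (auto intro!: mult_right_mono Basis_le_norm)
    finally show ?thesis by (simp add: \<epsilon>_def sum_distrib_left sum_distrib_right mult.commute)
  qed
  have "((\<lambda>s. \<epsilon> s * (2 * norm (T s (k s)))) \<longlongrightarrow> 0 * (2 * norm b)) F"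
    by (intro tendsto_intros \<epsilon> lim)
  then have small: "((\<lambda>s. \<epsilon> s * (2 * norm (T s (k s)))) \<longlongrightarrow> 0) F" by simp
  have "\<forall>\<^sub>F s in F. \<epsilon> s < 1/2" by (rule order_tendstoD(2)[OF \<epsilon>]) simp
  then have "\<forall>\<^sub>F s in F. norm (T s (k s) - k s) \<le> \<epsilon> s * (2 * norm (T s (k s)))"
  proof eventually_elim
    case (elim s)
    have "\<epsilon> s \<ge> 0" by (simp add: \<epsilon>_def sum_nonneg)
    have "\<epsilon> s * norm (k s) \<le> (1/2) * norm (k s)" using elim by (intro mult_right_mono) auto
    then have "norm (k s) \<le> 2 * norm (T s (k s))"
      using dev[of s "k s"] norm_triangle_ineq2[of "k s" "T s (k s)"] by (simp add: norm_minus_commute)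
    then show ?case using dev[of s "k s"] \<open>\<epsilon> s \<ge> 0\<close> by (meson mult_left_mono order_trans)
  qed
  then have "((\<lambda>s. T s (k s) - k s) \<longlongrightarrow> 0) F"
    using small by (rule Lim_null_comparison)
  from tendsto_diff[OF lim this] show ?thesis by simp
qed

lemma isCont_tendsto_nhds: "isCont f a \<Longrightarrow> (f \<longlongrightarrow> f a) (nhds a)"
  by (simp add: isCont_def tendsto_at_iff_tendsto_nhds)


section \<open>Tangent spaces in charts\<close>

locale atlas =
  fixes X :: "'g topology" and A :: "('g, 'v::euclidean_space) chart set"
  assumes manifold: "smooth_manifold X A"
begin

lemma chart_openin: "(U, \<phi>) \<in> A \<Longrightarrow> openin X U"
  using manifold unfolding smooth_manifold_def by blast

lemma chart_homeomorphic:
  "(U, \<phi>) \<in> A \<Longrightarrow> homeomorphic_map (subtopology X U) (top_of_set (\<phi> ` U)) \<phi>"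
  using manifold unfolding smooth_manifold_def by blast

lemma chart_open_range: "(U, \<phi>) \<in> A \<Longrightarrow> open (\<phi> ` U)"
  using manifold unfolding smooth_manifold_def by blast

lemma chart_topspace: "(U, \<phi>) \<in> A \<Longrightarrow> topspace (subtopology X U) = U"
  using openin_subset[OF chart_openin] by auto

lemma chart_inj: "(U, \<phi>) \<in> A \<Longrightarrow> inj_on \<phi> U"
  using chart_homeomorphic homeomorphic_imp_injective_map chart_topspace by metis

lemma chart_inv: "(U, \<phi>) \<in> A \<Longrightarrow> p \<in> U \<Longrightarrow> inv_into U \<phi> (\<phi> p) = p"
  by (simp add: chart_inj)

lemma chart_image_open:
  assumes "(U, \<phi>) \<in> A" "openin X W" "W \<subseteq> U"
  shows "open (\<phi> ` W)"
proof -
  have "openin (subtopology X U) W"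
    using assms chart_openin by (metis openin_open_subtopology)
  then have "openin (top_of_set (\<phi> ` U)) (\<phi> ` W)"
    using homeomorphic_imp_open_map[OF chart_homeomorphic[OF assms(1)]]
    unfolding open_map_def by blast
  then show ?thesis
    using chart_open_range[OF assms(1)] openin_open_eq by blast
qed

lemma chart_preimage_open:
  assumes "(U, \<phi>) \<in> A" "open Y"
  shows "openin X {p \<in> U. \<phi> p \<in> Y}"
proof -
  have "continuous_map (subtopology X U) (top_of_set (\<phi> ` U)) \<phi>"
    using homeomorphic_imp_continuous_map[OF chart_homeomorphic[OF assms(1)]] .
  then have "openin (subtopology X U) {p \<in> topspace (subtopology X U). \<phi> p \<in> \<phi> ` U \<inter> Y}"
    using assms(2) by (intro openin_continuous_map_preimage) auto
  moreover have "{p \<in> topspace (subtopology X U). \<phi> p \<in> \<phi> ` U \<inter> Y} = {p \<in> U. \<phi> p \<in> Y}"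
    using chart_topspace[OF assms(1)] by auto
  ultimately show ?thesis
    using openin_open_subtopology[OF chart_openin[OF assms(1)]] by simp
qed

lemma chart_change_smooth:
  "(U, \<phi>) \<in> A \<Longrightarrow> (V, \<psi>) \<in> A \<Longrightarrow> smooth_on (\<phi> ` (U \<inter> V)) (\<lambda>x. \<psi> (inv_into U \<phi> x))"
  using manifold unfolding smooth_manifold_def comp_def by fast

text \<open>Smoothness in a neighborhood needs to be checked in one chart only, since the transition maps are
  smooth.\<close>

lemma smooth_near_chartI:
  assumes UA: "(U, \<phi>) \<in> A" and W: "openin X W" "p \<in> W" "W \<subseteq> U"
    and f: "smooth_on (\<phi> ` W) (\<lambda>x. f (inv_into U \<phi> x))"
  shows "smooth_near X A p f"
proof -
  have "smooth_on (\<psi> ` (V \<inter> W)) (f \<circ> inv_into V \<psi>)" if VA: "(V, \<psi>) \<in> A" for V \<psi>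
  proof -
    have op: "open (\<psi> ` (V \<inter> W))"
      using chart_openin[OF VA] W(1) by (intro chart_image_open[OF VA]) auto
    have "smooth_on (\<psi> ` (V \<inter> W)) (\<lambda>x. f (inv_into U \<phi> (\<phi> (inv_into V \<psi> x))))"
    proof (rule smooth_on_compose[OF op chart_image_open[OF UA W(1,3)] _ _ f])
      show "smooth_on (\<psi> ` (V \<inter> W)) (\<lambda>x. \<phi> (inv_into V \<psi> x))"
        using W(3) by (intro smooth_on_subset[OF chart_change_smooth[OF VA UA]]) auto
      show "(\<lambda>x. \<phi> (inv_into V \<psi> x)) ` \<psi> ` (V \<inter> W) \<subseteq> \<phi> ` W"
        using chart_inv[OF VA] by auto
    qed
    then show ?thesis
    proof (rule smooth_on_cong[OF op, rotated])
      fix x assume "x \<in> \<psi> ` (V \<inter> W)"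
      then have "inv_into V \<psi> x \<in> U" using W(3) chart_inv[OF VA] by auto
      then show "f (inv_into U \<phi> (\<phi> (inv_into V \<psi> x))) = (f \<circ> inv_into V \<psi>) x"
        using chart_inv[OF UA] by simp
    qed
  qed
  then show ?thesis unfolding smooth_near_def using W by blast
qed

lemma smooth_near_chartE:
  assumes "smooth_near X A p f" "(U, \<phi>) \<in> A" "p \<in> U"
  obtains W where "openin X W" "p \<in> W" "W \<subseteq> U" "smooth_on (\<phi> ` W) (\<lambda>x. f (inv_into U \<phi> x))"
proof -
  obtain W where W: "openin X W" "p \<in> W" "smooth_on (\<phi> ` (U \<inter> W)) (f \<circ> inv_into U \<phi>)"
    using assms unfolding smooth_near_def by fast
  show thesis
    using W assms chart_openin that[of "U \<inter> W"] by (simp add: comp_def openin_Int)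
qed

lemma smooth_near_has_derivative:
  assumes "smooth_near X A p f" "(U, \<phi>) \<in> A" "p \<in> U"
  shows "((\<lambda>x. f (inv_into U \<phi> x)) has_derivative
     (\<lambda>w. dir_deriv (\<lambda>x. f (inv_into U \<phi> x)) w (\<phi> p))) (at (\<phi> p))"
  using assms by (elim smooth_near_chartE) (auto intro: smooth_on_has_derivative)

lemma coord_vec_smooth:
  "smooth_near X A p f \<Longrightarrow> coord_vec X A (U, \<phi>) p w f = dir_deriv (\<lambda>x. f (inv_into U \<phi> x)) w (\<phi> p)"
  by (simp add: coord_vec_def comp_def)

lemma coord_vec_not_smooth: "\<not> smooth_near X A p f \<Longrightarrow> coord_vec X A (U, \<phi>) p w f = 0"
  by (simp add: coord_vec_def)

lemma linear_coord_vec: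
  assumes "(U, \<phi>) \<in> A" "p \<in> U"
  shows "linear (coord_vec X A (U, \<phi>) p)"
proof (rule linearI; rule ext)
  fix w z c f
  show "coord_vec X A (U, \<phi>) p (w + z) f = (coord_vec X A (U, \<phi>) p w + coord_vec X A (U, \<phi>) p z) f"
    using linear_add[OF has_derivative_linear[OF smooth_near_has_derivative]] assms
    by (cases "smooth_near X A p f") (simp_all add: coord_vec_smooth coord_vec_not_smooth)
  show "coord_vec X A (U, \<phi>) p (c *\<^sub>R w) f = (c *\<^sub>R coord_vec X A (U, \<phi>) p w) f"
    using linear_scale[OF has_derivative_linear[OF smooth_near_has_derivative]] assms
    by (cases "smooth_near X A p f") (simp_all add: coord_vec_smooth coord_vec_not_smooth scaleR_fun_def)
qed

lemma coord_vec_change: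
  assumes UA: "(U, \<phi>) \<in> A" and VA: "(V, \<psi>) \<in> A" and p: "p \<in> U" "p \<in> V"
  shows "coord_vec X A (V, \<psi>) p w
    = coord_vec X A (U, \<phi>) p (dir_deriv (\<lambda>x. \<phi> (inv_into V \<psi> x)) w (\<psi> p))"
proof
  fix f
  show "coord_vec X A (V, \<psi>) p w f
    = coord_vec X A (U, \<phi>) p (dir_deriv (\<lambda>x. \<phi> (inv_into V \<psi> x)) w (\<psi> p)) f"
  proof (cases "smooth_near X A p f")
    case True
    let ?f = "\<lambda>x. f (inv_into U \<phi> x)" and ?\<tau> = "\<lambda>x. \<phi> (inv_into V \<psi> x)"
    have op: "open (\<psi> ` (V \<inter> U))"
      using chart_openin[OF VA] chart_openin[OF UA] by (intro chart_image_open[OF VA]) auto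
    have \<psi>p: "\<psi> p \<in> \<psi> ` (V \<inter> U)" using p by auto
    have "(?\<tau> has_derivative (\<lambda>w. dir_deriv ?\<tau> w (\<psi> p))) (at (\<psi> p))"
      by (rule smooth_on_has_derivative[OF chart_change_smooth[OF VA UA] \<psi>p])
    moreover have "(?f has_derivative (\<lambda>w. dir_deriv ?f w (\<phi> p))) (at (?\<tau> (\<psi> p)))"
      using smooth_near_has_derivative[OF True UA p(1)] chart_inv[OF VA p(2)] by simp
    ultimately have "((\<lambda>x. ?f (?\<tau> x)) has_derivative (\<lambda>w. dir_deriv ?f (dir_deriv ?\<tau> w (\<psi> p)) (\<phi> p))) (at (\<psi> p))"
      by (rule has_derivative_compose)
    then have "dir_deriv (\<lambda>x. ?f (?\<tau> x)) w (\<psi> p) = dir_deriv ?f (dir_deriv ?\<tau> w (\<psi> p)) (\<phi> p)"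
      by (rule dir_deriv_eqI)
    moreover have "frechet_derivative (\<lambda>x. ?f (?\<tau> x)) (at (\<psi> p)) = frechet_derivative (\<lambda>x. f (inv_into V \<psi> x)) (at (\<psi> p))"
    proof (rule frechet_derivative_cong_open[OF op \<psi>p])
      fix y assume "y \<in> \<psi> ` (V \<inter> U)"
      then have "inv_into V \<psi> y \<in> U" using chart_inv[OF VA] by auto
      then show "?f (?\<tau> y) = f (inv_into V \<psi> y)" using chart_inv[OF UA] by simp
    qed
    ultimately show ?thesis using True by (simp add: coord_vec_smooth)
  qed (simp add: coord_vec_not_smooth)
qed

text \<open>Since a change of charts acts on components by the derivative of the transition map, a single
  chart already yields all tangent vectors; in particular they form a vector space.\<close>

lemma tangent_space_eq_range:
  assumes "(U, \<phi>) \<in> A" "p \<in> U"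
  shows "tangent_space X A p = range (coord_vec X A (U, \<phi>) p)"
proof
  show "range (coord_vec X A (U, \<phi>) p) \<subseteq> tangent_space X A p"
    unfolding tangent_space_def using assms by blast
  show "tangent_space X A p \<subseteq> range (coord_vec X A (U, \<phi>) p)"
    unfolding tangent_space_def using coord_vec_change[OF assms(1) _ assms(2)] by blast
qed

end


section \<open>The Lie bracket in a chart\<close>

lemma smooth_map_in_charts:
  assumes "smooth_map X A Y B h" "(U, \<phi>) \<in> A" "(V, \<psi>) \<in> B"
  shows "smooth_on (\<phi> ` {p \<in> U. h p \<in> V}) (\<psi> \<circ> h \<circ> inv_into U \<phi>)"
proof -
  have "\<forall>(U, \<phi>)\<in>A. \<forall>(V, \<psi>)\<in>B. smooth_on (\<phi> ` {p \<in> U. h p \<in> V}) (\<psi> \<circ> h \<circ> inv_into U \<phi>)"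
    using assms(1) unfolding smooth_map_def by (rule conjunct2)
  from bspec[OF bspec[OF this assms(2), unfolded prod.case] assms(3)] show ?thesis by simp
qed

text \<open>A Lie group together with a chart around the identity. All that follows is local at the identity,
  so this one chart suffices.\<close>

locale lie_chart = atlas X A + group G
  for X :: "'g topology" and A :: "('g, 'v::euclidean_space) chart set" and G :: "'g monoid" (structure) +
  fixes U :: "'g set" and \<phi> :: "'g \<Rightarrow> 'v"
  assumes lie: "lie_group X A G"
    and chart: "(U, \<phi>) \<in> A"
    and one_in: "\<one> \<in> U"
begin

abbreviation pt :: "'v \<Rightarrow> 'g" where "pt \<equiv> inv_into U \<phi>"
abbreviation x0 :: 'v where "x0 \<equiv> \<phi> \<one>"

definition mul :: "'v \<times> 'v \<Rightarrow> 'v" where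
  "mul z = \<phi> (pt (fst z) \<otimes> pt (snd z))"

text \<open>The coordinate form of multiplication, \<open>mul\<close>, is meaningful only for pairs whose product stays in
  the chart. A smaller target \<open>W\<close> is allowed because test functions are smooth only on a smaller
  neighborhood of the identity.\<close>

definition mul_dom :: "'g set \<Rightarrow> ('v \<times> 'v) set" where
  "mul_dom W = {z. fst z \<in> \<phi> ` U \<and> snd z \<in> \<phi> ` U \<and> pt (fst z) \<otimes> pt (snd z) \<in> W}"

lemma topspace_eq: "topspace X = carrier G"
  using lie unfolding lie_group_def by blast

lemma chart_sub: "U \<subseteq> carrier G"
  using openin_subset[OF chart_openin[OF chart]] topspace_eq by simp

lemma pt_in: "x \<in> \<phi> ` U \<Longrightarrow> pt x \<in> U"
  by (simp add: inv_into_into)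

lemma phi_pt: "x \<in> \<phi> ` U \<Longrightarrow> \<phi> (pt x) = x"
  by (simp add: f_inv_into_f)

lemma pt_phi: "p \<in> U \<Longrightarrow> pt (\<phi> p) = p"
  by (rule chart_inv[OF chart])

lemma pt_carrier: "x \<in> \<phi> ` U \<Longrightarrow> pt x \<in> carrier G"
  using pt_in chart_sub by blast

lemma in_mul_dom: "p \<in> U \<Longrightarrow> q \<in> U \<Longrightarrow> p \<otimes> q \<in> W \<Longrightarrow> (\<phi> p, \<phi> q) \<in> mul_dom W"
  by (simp add: mul_dom_def pt_phi)

lemma mul_phi: "p \<in> U \<Longrightarrow> q \<in> U \<Longrightarrow> mul (\<phi> p, \<phi> q) = \<phi> (p \<otimes> q)"
  by (simp add: mul_def pt_phi)

lemma mul_dom_mono: "W \<subseteq> W' \<Longrightarrow> mul_dom W \<subseteq> mul_dom W'"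
  by (auto simp: mul_dom_def)

lemma open_mul_dom:
  assumes "openin X W"
  shows "open (mul_dom W)"
proof (subst open_subopen, intro ballI)
  fix z assume z: "z \<in> mul_dom W"
  let ?O = "{q \<in> topspace (prod_topology X X). (\<lambda>(p, q). p \<otimes> q) q \<in> W}"
  have "continuous_map (prod_topology X X) X (\<lambda>(p, q). p \<otimes> q)"
    using lie unfolding lie_group_def smooth_map_def by blast
  then have O: "openin (prod_topology X X) ?O"
    by (rule openin_continuous_map_preimage[OF _ assms])
  have in_O: "(pt (fst z), pt (snd z)) \<in> ?O"
    using z pt_carrier by (auto simp: mul_dom_def topspace_eq)
  from openin_prod_topology_alt[THEN iffD1, OF O, rule_format, OF in_O]
  obtain P Q where PQ: "openin X P" "openin X Q" "pt (fst z) \<in> P" "pt (snd z) \<in> Q" "P \<times> Q \<subseteq> ?O"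
    by (elim exE conjE)
  have "open (\<phi> ` (P \<inter> U) \<times> \<phi> ` (Q \<inter> U))"
    using PQ chart_openin[OF chart] by (intro open_Times chart_image_open[OF chart]) auto
  moreover have "z \<in> \<phi> ` (P \<inter> U) \<times> \<phi> ` (Q \<inter> U)"
  proof -
    have zU: "fst z \<in> \<phi> ` U" "snd z \<in> \<phi> ` U" using z by (simp_all add: mul_dom_def)
    have "(\<phi> (pt (fst z)), \<phi> (pt (snd z))) \<in> \<phi> ` (P \<inter> U) \<times> \<phi> ` (Q \<inter> U)"
      by (intro SigmaI imageI IntI PQ(3,4) pt_in zU)
    then show ?thesis using zU by (simp add: phi_pt)
  qed
  moreover have "\<phi> ` (P \<inter> U) \<times> \<phi> ` (Q \<inter> U) \<subseteq> mul_dom W"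
    using PQ(5) by (auto simp: mul_dom_def pt_phi)
  ultimately show "\<exists>T. open T \<and> z \<in> T \<and> T \<subseteq> mul_dom W" by blast
qed

lemma smooth_mul: "smooth_on (mul_dom U) mul"
proof -
  let ?m = "\<lambda>(p, q). p \<otimes> q" and ?\<Phi> = "map_prod \<phi> \<phi>"
  have "(U \<times> U, ?\<Phi>) \<in> product_atlas A A"
    unfolding product_atlas_def using chart by blast
  then have s: "smooth_on (?\<Phi> ` {p \<in> U \<times> U. ?m p \<in> U}) (\<phi> \<circ> ?m \<circ> inv_into (U \<times> U) ?\<Phi>)"
    using lie unfolding lie_group_def by (intro smooth_map_in_charts[OF _ _ chart]) blast+
  have inj: "inj_on ?\<Phi> (U \<times> U)"
    using chart_inj[OF chart] by (intro map_prod_inj_on)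
  have im: "?\<Phi> ` {p \<in> U \<times> U. ?m p \<in> U} = mul_dom U"
  proof
    show "?\<Phi> ` {p \<in> U \<times> U. ?m p \<in> U} \<subseteq> mul_dom U"
      by (auto simp: mul_dom_def pt_phi)
    show "mul_dom U \<subseteq> ?\<Phi> ` {p \<in> U \<times> U. ?m p \<in> U}"
    proof
      fix z assume z: "z \<in> mul_dom U"
      then have "z = ?\<Phi> (pt (fst z), pt (snd z))"
        by (simp add: mul_dom_def phi_pt)
      moreover have "(pt (fst z), pt (snd z)) \<in> {p \<in> U \<times> U. ?m p \<in> U}"
        using z by (simp add: mul_dom_def pt_in)
      ultimately show "z \<in> ?\<Phi> ` {p \<in> U \<times> U. ?m p \<in> U}" by blast
    qed
  qed
  show ?thesis
  proof (rule smooth_on_cong[OF open_mul_dom[OF chart_openin[OF chart]] _ s[unfolded im]])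
    fix z assume z: "z \<in> mul_dom U"
    have "inv_into (U \<times> U) ?\<Phi> z = (pt (fst z), pt (snd z))"
      using z by (intro inv_into_f_eq[OF inj]) (auto simp: mul_dom_def pt_in phi_pt)
    then show "(\<phi> \<circ> ?m \<circ> inv_into (U \<times> U) ?\<Phi>) z = mul z"
      by (simp add: mul_def)
  qed
qed

lemma mul_has_derivative:
  "p \<in> U \<Longrightarrow> q \<in> U \<Longrightarrow> p \<otimes> q \<in> U \<Longrightarrow>
   (mul has_derivative (\<lambda>v. dir_deriv mul v (\<phi> p, \<phi> q))) (at (\<phi> p, \<phi> q))"
  using smooth_on_has_derivative[OF smooth_mul] in_mul_dom by blast

definition inv_dom :: "'v set" where
  "inv_dom = {x \<in> \<phi> ` U. inv (pt x) \<in> U}"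

lemma inv_dom_eq: "inv_dom = \<phi> ` {p \<in> U. inv p \<in> U}"
  unfolding inv_dom_def by (auto simp: pt_phi)

lemma open_inv_dom: "open inv_dom"
proof -
  have "continuous_map X X (\<lambda>p. inv p)"
    using lie unfolding lie_group_def smooth_map_def by blast
  from openin_continuous_map_preimage[OF this chart_openin[OF chart]]
  have "openin X (U \<inter> {p \<in> topspace X. inv p \<in> U})"
    using chart_openin[OF chart] by (rule openin_Int[rotated])
  moreover have "U \<inter> {p \<in> topspace X. inv p \<in> U} = {p \<in> U. inv p \<in> U}"
    using chart_sub topspace_eq by auto
  ultimately show ?thesis
    unfolding inv_dom_eq by (intro chart_image_open[OF chart]) auto
qed

lemma smooth_inv: "smooth_on inv_dom (\<lambda>x. \<phi> (inv (pt x)))"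
proof -
  have "smooth_map X A X A (\<lambda>p. inv p)" using lie unfolding lie_group_def by blast
  from smooth_map_in_charts[OF this chart chart] show ?thesis
    unfolding inv_dom_eq comp_def .
qed

definition Vec :: "'v \<Rightarrow> 'g tvec" where
  "Vec = coord_vec X A (U, \<phi>) \<one>"

lemma linear_Vec: "linear Vec"
  unfolding Vec_def by (rule linear_coord_vec[OF chart one_in])

lemma lie_algebra_eq_range_Vec: "lie_algebra X A G = range Vec"
  unfolding lie_algebra_def Vec_def by (rule tangent_space_eq_range[OF chart one_in])

lemma one_right: "x \<in> \<phi> ` U \<Longrightarrow> pt x \<otimes> pt x0 = pt x"
  using pt_carrier one_in by (simp add: pt_phi)

lemma one_left: "x \<in> \<phi> ` U \<Longrightarrow> pt x0 \<otimes> pt x = pt x"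
  using pt_carrier one_in by (simp add: pt_phi)

lemma in_mul_dom_one: "x \<in> \<phi> ` W \<Longrightarrow> W \<subseteq> U \<Longrightarrow> (x, x0) \<in> mul_dom W" "x \<in> \<phi> ` W \<Longrightarrow> W \<subseteq> U \<Longrightarrow> (x0, x) \<in> mul_dom W"
  using one_in one_right[of x] one_left[of x] by (auto simp: mul_dom_def pt_phi)

lemma mul_one: "x \<in> \<phi> ` U \<Longrightarrow> mul (x, x0) = x" "x \<in> \<phi> ` U \<Longrightarrow> mul (x0, x) = x"
  by (simp_all add: mul_def one_right one_left phi_pt)

lemma smooth_mul_function:
  assumes W: "openin X W" "W \<subseteq> U" and f: "smooth_on (\<phi> ` W) (\<lambda>x. f (pt x))"
  shows "smooth_on (mul_dom W) (\<lambda>z. f (pt (fst z) \<otimes> pt (snd z)))"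
proof -
  have "smooth_on (mul_dom W) (\<lambda>z. f (pt (mul z)))"
  proof (rule smooth_on_compose[OF open_mul_dom[OF W(1)] chart_image_open[OF chart W] _ _ f])
    show "mul ` mul_dom W \<subseteq> \<phi> ` W" by (auto simp: mul_dom_def mul_def)
    show "smooth_on (mul_dom W) mul"
      by (rule smooth_on_subset[OF smooth_mul mul_dom_mono[OF W(2)]])
  qed
  then show ?thesis
    using W by (elim smooth_on_cong[OF open_mul_dom[OF W(1)], rotated]) (auto simp: mul_def mul_dom_def pt_phi subset_iff)
qed

text \<open>A left translate of \<open>f\<close> is smooth near the identity, so that the tangent vector \<open>Vec w\<close> acts on it
  as a genuine directional derivative and not through its default value \<open>0\<close>.\<close>

lemma left_invariant_field_dir_deriv:
  assumes W: "openin X W" "W \<subseteq> U" and f: "smooth_on (\<phi> ` W) (\<lambda>x. f (pt x))" and q: "q \<in> W"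
  shows "left_invariant_field G (Vec w) q f = dir_deriv (\<lambda>y. f (q \<otimes> pt y)) w x0"
proof -
  define Y where "Y = {y. (\<phi> q, y) \<in> mul_dom W}"
  have "q \<in> U" using q W by auto
  have Y: "open Y"
    unfolding Y_def using open_vimage[OF open_mul_dom[OF W(1)], of "\<lambda>y. (\<phi> q, y)"]
    by (simp add: vimage_def continuous_on_Pair)
  have s: "smooth_on Y (\<lambda>y. f (q \<otimes> pt y))"
  proof -
    have "smooth_on Y (\<lambda>y. f (pt (fst (\<phi> q, y)) \<otimes> pt (snd (\<phi> q, y))))"
      by (rule smooth_on_compose[OF Y open_mul_dom[OF W(1)] _ _ smooth_mul_function[where f = f, OF W f]])
        (auto simp: Y_def intro: smooth_on_Pair[OF Y smooth_on_const smooth_on_ident, unfolded Y_def])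
    then show ?thesis using \<open>q \<in> U\<close> by (simp add: pt_phi)
  qed
  have "x0 \<in> Y" unfolding Y_def using in_mul_dom_one(1)[of "\<phi> q" W] q W by auto
  have "smooth_near X A \<one> (\<lambda>r. f (q \<otimes> r))"
  proof (rule smooth_near_chartI[OF chart chart_preimage_open[OF chart Y]])
    show "\<one> \<in> {p \<in> U. \<phi> p \<in> Y}" using one_in \<open>x0 \<in> Y\<close> by simp
    show "smooth_on (\<phi> ` {p \<in> U. \<phi> p \<in> Y}) (\<lambda>y. f (q \<otimes> pt y))"
      by (rule smooth_on_subset[OF s]) auto
  qed auto
  then show ?thesis
    unfolding left_invariant_field_def push_forward_def Vec_def comp_def by (rule coord_vec_smooth)
qed

text \<open>The components at \<open>x\<close> of the left-invariant (respectively right-invariant) vector field with value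
  \<open>v\<close> at the identity.\<close>

definition left_field :: "'v \<Rightarrow> 'v \<Rightarrow> 'v" where
  "left_field v x = dir_deriv mul (0, v) (x, x0)"

definition right_field :: "'v \<Rightarrow> 'v \<Rightarrow> 'v" where
  "right_field v x = dir_deriv mul (v, 0) (x0, x)"

definition mixed_deriv :: "'v \<Rightarrow> 'v \<Rightarrow> 'v" where
  "mixed_deriv u v = dir_deriv (dir_deriv mul (0, v)) (u, 0) (x0, x0)"

lemma x0_in: "x0 \<in> \<phi> ` U"
  using one_in by blast

text \<open>Multiplication is to first order addition, because it restricts to the identity map when one
  factor is the neutral element.\<close>

lemma dir_deriv_mul_one: "dir_deriv mul (v, w) (x0, x0) = v + w"
proof -
  let ?D = "\<lambda>z. dir_deriv mul z (x0, x0)"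
  have D: "(mul has_derivative ?D) (at (x0, x0))"
    using smooth_on_has_derivative[OF smooth_mul] in_mul_dom_one x0_in by blast
  have "((\<lambda>x. mul (x, x0)) has_derivative (\<lambda>v. ?D (v, 0))) (at x0)"
    by (rule has_derivative_compose[of "\<lambda>x. (x, x0)" "\<lambda>v. (v, 0)", OF _ D])
      (intro has_derivative_Pair has_derivative_ident has_derivative_const)
  moreover have "((\<lambda>x. mul (x, x0)) has_derivative (\<lambda>v. v)) (at x0)"
    by (rule has_derivative_transform_within_open[OF has_derivative_ident chart_open_range[OF chart] x0_in])
      (simp add: mul_one)
  ultimately have "(\<lambda>v. ?D (v, 0)) = (\<lambda>v. v)" by (rule has_derivative_unique)
  then have 1: "?D (v, 0) = v" by metis
  have "((\<lambda>x. mul (x0, x)) has_derivative (\<lambda>v. ?D (0, v))) (at x0)"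
    by (rule has_derivative_compose[of "\<lambda>x. (x0, x)" "\<lambda>v. (0, v)", OF _ D])
      (intro has_derivative_Pair has_derivative_ident has_derivative_const)
  moreover have "((\<lambda>x. mul (x0, x)) has_derivative (\<lambda>v. v)) (at x0)"
    by (rule has_derivative_transform_within_open[OF has_derivative_ident chart_open_range[OF chart] x0_in])
      (simp add: mul_one)
  ultimately have "(\<lambda>v. ?D (0, v)) = (\<lambda>v. v)" by (rule has_derivative_unique)
  then have 2: "?D (0, w) = w" by metis
  have "?D ((v, 0) + (0, w)) = ?D (v, 0) + ?D (0, w)"
    by (rule linear_add[OF has_derivative_linear[OF D]])
  then show ?thesis using 1 2 by simp
qed

lemma left_field_one: "left_field v x0 = v" and right_field_one: "right_field v x0 = v"
  by (simp_all add: left_field_def right_field_def dir_deriv_mul_one)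

lemma left_field_has_derivative: "(left_field v has_derivative (\<lambda>u. mixed_deriv u v)) (at x0)"
proof -
  have "(dir_deriv mul (0, v) has_derivative (\<lambda>z. dir_deriv (dir_deriv mul (0, v)) z (x0, x0))) (at (x0, x0))"
    using smooth_on_has_derivative[OF smooth_on_dir_deriv[OF smooth_mul]] in_mul_dom_one x0_in by blast
  from has_derivative_compose[of "\<lambda>x. (x, x0)" "\<lambda>v. (v, 0)", OF _ this]
  show ?thesis unfolding left_field_def mixed_deriv_def
    by (simp add: has_derivative_Pair[OF has_derivative_ident has_derivative_const])
qed

text \<open>The roles of the two arguments of \<open>mixed_deriv\<close> are exchanged in comparison with the
  left-invariant field, by the symmetry of second derivatives. This is why the Lie bracket measures the difference of
  left-invariant and right-invariant fields.\<close>

lemma right_field_has_derivative: "(right_field v has_derivative (\<lambda>u. mixed_deriv v u)) (at x0)"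
proof -
  have "(dir_deriv mul (v, 0) has_derivative (\<lambda>z. dir_deriv (dir_deriv mul (v, 0)) z (x0, x0))) (at (x0, x0))"
    using smooth_on_has_derivative[OF smooth_on_dir_deriv[OF smooth_mul]] in_mul_dom_one x0_in by blast
  from has_derivative_compose[of "\<lambda>x. (x0, x)" "\<lambda>v. (0, v)", OF _ this]
  have "(right_field v has_derivative (\<lambda>u. dir_deriv (dir_deriv mul (v, 0)) (0, u) (x0, x0))) (at x0)"
    unfolding right_field_def by (simp add: has_derivative_Pair[OF has_derivative_const has_derivative_ident])
  moreover have "dir_deriv (dir_deriv mul (v, 0)) (0, u) (x0, x0) = mixed_deriv v u" for u
    unfolding mixed_deriv_def using in_mul_dom_one x0_in smooth_mul
    by (intro dir_deriv_commute[OF open_mul_dom[OF chart_openin[OF chart]]]) (auto simp: smooth_on_def)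
  ultimately show ?thesis by simp
qed

lemma left_invariant_field_in_chart:
  assumes W: "openin X W" "W \<subseteq> U" and f: "smooth_on (\<phi> ` W) (\<lambda>x. f (pt x))" and q: "q \<in> W"
  shows "left_invariant_field G (Vec w) q f = dir_deriv (\<lambda>x. f (pt x)) (left_field w (\<phi> q)) (\<phi> q)"
proof -
  have "q \<in> U" using q W by auto
  then have "(\<phi> q, x0) \<in> mul_dom U" using in_mul_dom_one by blast
  from smooth_on_has_derivative[OF smooth_mul this]
  have "((\<lambda>y. mul (\<phi> q, y)) has_derivative (\<lambda>w. dir_deriv mul (0, w) (\<phi> q, x0))) (at x0)"
    by (rule has_derivative_compose[of "\<lambda>y. (\<phi> q, y)" "\<lambda>w. (0, w)", rotated])
      (intro has_derivative_Pair has_derivative_ident has_derivative_const)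
  moreover have "((\<lambda>x. f (pt x)) has_derivative (\<lambda>w. dir_deriv (\<lambda>x. f (pt x)) w (\<phi> q))) (at (mul (\<phi> q, x0)))"
    using smooth_on_has_derivative[OF f] q \<open>q \<in> U\<close> by (simp add: mul_one)
  ultimately have "((\<lambda>y. f (pt (mul (\<phi> q, y)))) has_derivative
      (\<lambda>w. dir_deriv (\<lambda>x. f (pt x)) (left_field w (\<phi> q)) (\<phi> q))) (at x0)"
    unfolding left_field_def by (rule has_derivative_compose)
  from dir_deriv_eqI[OF this]
  have "dir_deriv (\<lambda>y. f (pt (mul (\<phi> q, y)))) w x0 = dir_deriv (\<lambda>x. f (pt x)) (left_field w (\<phi> q)) (\<phi> q)" .
  moreover have "frechet_derivative (\<lambda>y. f (pt (mul (\<phi> q, y)))) (at x0) = frechet_derivative (\<lambda>y. f (q \<otimes> pt y)) (at x0)"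
  proof (rule frechet_derivative_cong_open)
    show "open {y. (\<phi> q, y) \<in> mul_dom U}"
      using open_vimage[OF open_mul_dom[OF chart_openin[OF chart]], of "\<lambda>y. (\<phi> q, y)"]
      by (simp add: vimage_def continuous_on_Pair)
    show "x0 \<in> {y. (\<phi> q, y) \<in> mul_dom U}" using \<open>(\<phi> q, x0) \<in> mul_dom U\<close> by simp
    show "f (pt (mul (\<phi> q, y))) = f (q \<otimes> pt y)" if "y \<in> {y. (\<phi> q, y) \<in> mul_dom U}" for y
      using that \<open>q \<in> U\<close> by (simp add: mul_def mul_dom_def pt_phi)
  qed
  ultimately show ?thesis using left_invariant_field_dir_deriv[OF W f q] by simp
qed

text \<open>Applying one left-invariant field after another to \<open>f\<close> gives a second derivative of \<open>f\<close>, which is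
  symmetric and cancels in the commutator, plus the first derivative of \<open>f\<close> in the direction in which
  the inner field changes.\<close>

lemma lie_bracket_Vec: "lie_bracket X A G (Vec u) (Vec v) = Vec (mixed_deriv u v - mixed_deriv v u)"
proof
  fix f
  show "lie_bracket X A G (Vec u) (Vec v) f = Vec (mixed_deriv u v - mixed_deriv v u) f"
  proof (cases "smooth_near X A \<one> f")
    case True
    then obtain W where W: "openin X W" "\<one> \<in> W" "W \<subseteq> U" and f: "smooth_on (\<phi> ` W) (\<lambda>x. f (pt x))"
      using smooth_near_chartE[OF _ chart one_in] by metis
    let ?f = "\<lambda>x. f (pt x)"
    have op: "open (\<phi> ` W)" and x0W: "x0 \<in> \<phi> ` W"
      using chart_image_open[OF chart W(1,3)] W(2) by auto
    have lin: "linear (\<lambda>w. dir_deriv ?f w x0)"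
      by (rule has_derivative_linear[OF smooth_on_has_derivative[OF f x0W]])
    have iter: "left_invariant_field G (Vec u) \<one> (\<lambda>q. left_invariant_field G (Vec v) q f)
      = dir_deriv (dir_deriv ?f v) u x0 + dir_deriv ?f (mixed_deriv u v) x0" for u v
    proof -
      let ?g = "\<lambda>q. left_invariant_field G (Vec v) q f"
      have g: "?g (pt x) = dir_deriv ?f (left_field v x) x" if x: "x \<in> \<phi> ` W" for x
      proof -
        have "pt x \<in> W" "\<phi> (pt x) = x" using x W(3) by (auto simp: pt_phi subset_iff)
        then show ?thesis using left_invariant_field_in_chart[OF W(1,3) f, of "pt x" v] by simp
      qed
      \<comment> \<open>As a function of the base point, \<open>?g\<close> is a partial derivative of the smooth function
        \<open>(x, y) \<mapsto> f (x y)\<close> at \<open>y = 1\<close>, and so is itself smooth.\<close>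
      have "smooth_on (\<phi> ` W) (\<lambda>x. ?g (pt x))"
      proof (rule smooth_on_cong[OF op])
        show "smooth_on (\<phi> ` W) (\<lambda>x. dir_deriv (\<lambda>z. f (pt (fst z) \<otimes> pt (snd z))) (0, v) (x, x0))"
          by (rule smooth_on_compose[OF op open_mul_dom[OF W(1)] _ smooth_on_Pair[OF op smooth_on_ident smooth_on_const]
                smooth_on_dir_deriv[OF smooth_mul_function[where f = f, OF W(1,3) f]]])
            (use in_mul_dom_one W(3) in auto)
        show "dir_deriv (\<lambda>z. f (pt (fst z) \<otimes> pt (snd z))) (0, v) (x, x0) = ?g (pt x)" if x: "x \<in> \<phi> ` W" for x
        proof -
          have ptx: "pt x \<in> W" "\<phi> (pt x) = x" "pt x \<in> U" using x W(3) by (auto simp: pt_phi subset_iff)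
          have "(x, x0) \<in> mul_dom W" using in_mul_dom_one x W(3) by blast
          from smooth_on_has_derivative[OF smooth_mul_function[where f = f, OF W(1,3) f] this]
          have "((\<lambda>y. f (pt (fst (x, y)) \<otimes> pt (snd (x, y)))) has_derivative
              (\<lambda>w. dir_deriv (\<lambda>z. f (pt (fst z) \<otimes> pt (snd z))) (0, w) (x, x0))) (at x0)"
            by (rule has_derivative_compose[of "\<lambda>y. (x, y)" "\<lambda>w. (0, w)", rotated])
              (intro has_derivative_Pair has_derivative_ident has_derivative_const)
          from dir_deriv_eqI[OF this] show ?thesis
            using left_invariant_field_dir_deriv[OF W(1,3) f ptx(1), of v] by simp
        qed
      qed
      from left_invariant_field_in_chart[OF W(1,3) this W(2), of u]
      have "left_invariant_field G (Vec u) \<one> ?g = dir_deriv (\<lambda>x. ?g (pt x)) u x0"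
        by (simp add: left_field_one)
      also have "\<dots> = dir_deriv (\<lambda>x. dir_deriv ?f (left_field v x) x) u x0"
        using frechet_derivative_cong_open[OF op x0W g] by simp
      also have "\<dots> = dir_deriv (dir_deriv ?f v) u x0 + dir_deriv ?f (mixed_deriv u v) x0"
        using dir_deriv_along_field[OF op x0W f left_field_has_derivative] by (simp add: left_field_one)
      finally show ?thesis .
    qed
    have "dir_deriv (dir_deriv ?f v) u x0 = dir_deriv (dir_deriv ?f u) v x0"
      using f by (intro dir_deriv_commute[OF op _ x0W]) (simp add: smooth_on_def)
    then have "lie_bracket X A G (Vec u) (Vec v) f = dir_deriv ?f (mixed_deriv u v) x0 - dir_deriv ?f (mixed_deriv v u) x0"
      using True by (simp add: lie_bracket_def field_bracket_def iter)
    also have "\<dots> = dir_deriv ?f (mixed_deriv u v - mixed_deriv v u) x0"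
      by (rule linear_diff[OF lin, symmetric])
    finally show ?thesis using coord_vec_smooth[OF True] by (simp add: Vec_def)
  next
    case False
    then show ?thesis
      using coord_vec_not_smooth[OF False] by (simp add: lie_bracket_def field_bracket_def Vec_def)
  qed
qed

end


section \<open>Velocities of curves in subgroups\<close>

context lie_chart begin

text \<open>Differentiability is required at time \<open>0\<close> only, where the chain rule is applied. The condition that \<open>c\<close> stays in the chart for small
  times replaces continuity of \<open>c\<close>: outside of \<open>U\<close> the values of \<open>\<phi>\<close> are arbitrary.\<close>

definition has_velocity :: "(real \<Rightarrow> 'g) \<Rightarrow> 'g \<Rightarrow> 'v \<Rightarrow> bool" where
  "has_velocity c p v \<longleftrightarrow> c 0 = p \<and> range c \<subseteq> carrier G \<and> (\<forall>\<^sub>F t in nhds 0. c t \<in> U) \<and>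
     ((\<lambda>t. \<phi> (c t)) has_vector_derivative v) (at 0)"

lemma has_velocity_in_chart: "has_velocity c p v \<Longrightarrow> p \<in> U"
  unfolding has_velocity_def by (metis eventually_nhds_x_imp_x)

lemma has_velocity_unique: "has_velocity c p v \<Longrightarrow> has_velocity c p w \<Longrightarrow> v = w"
  unfolding has_velocity_def using vector_derivative_unique_at by blast

lemma has_velocity_const: "p \<in> U \<Longrightarrow> has_velocity (\<lambda>_. p) p 0"
  using chart_sub by (auto simp: has_velocity_def)

lemma has_velocity_scale:
  assumes "has_velocity c p v"
  shows "has_velocity (\<lambda>t. c (r * t)) p (r *\<^sub>R v)"
proof -
  have c: "c 0 = p" "range c \<subseteq> carrier G" "\<forall>\<^sub>F t in nhds 0. c t \<in> U"
    "((\<lambda>t. \<phi> (c t)) has_vector_derivative v) (at (r * 0))"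
    using assms by (simp_all add: has_velocity_def)
  have "((\<lambda>t. r * t) \<longlongrightarrow> r * 0) (nhds 0)" by (intro tendsto_mult tendsto_const filterlim_ident)
  then have ev: "\<forall>\<^sub>F t in nhds 0. c (r * t) \<in> U"
    using eventually_compose_filterlim[OF c(3)] by simp
  have "((\<lambda>t. r * t) has_vector_derivative r) (at 0)"
    by (auto intro!: derivative_eq_intros)
  from vector_diff_chain_at[OF this c(4)]
  show ?thesis using c ev by (auto simp: has_velocity_def comp_def)
qed

lemma has_velocity_mult:
  assumes c: "has_velocity c p v" and d: "has_velocity d q w" and pq: "p \<otimes> q \<in> U"
  shows "has_velocity (\<lambda>t. c t \<otimes> d t) (p \<otimes> q) (dir_deriv mul (v, w) (\<phi> p, \<phi> q))"
proof -
  have cd: "c 0 = p" "d 0 = q" "range c \<subseteq> carrier G" "range d \<subseteq> carrier G"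
    "\<forall>\<^sub>F t in nhds 0. c t \<in> U" "\<forall>\<^sub>F t in nhds 0. d t \<in> U"
    "((\<lambda>t. \<phi> (c t)) has_derivative (\<lambda>t. t *\<^sub>R v)) (at 0)" "((\<lambda>t. \<phi> (d t)) has_derivative (\<lambda>t. t *\<^sub>R w)) (at 0)"
    using c d by (simp_all add: has_velocity_def has_vector_derivative_def)
  note U = has_velocity_in_chart[OF c] has_velocity_in_chart[OF d]
  have pair: "((\<lambda>t. (\<phi> (c t), \<phi> (d t))) has_derivative (\<lambda>t. (t *\<^sub>R v, t *\<^sub>R w))) (at 0)"
    by (intro has_derivative_Pair cd)
  have dom: "(\<phi> p, \<phi> q) \<in> mul_dom U" by (rule in_mul_dom[OF U pq])
  have "((\<lambda>t. (\<phi> (c t), \<phi> (d t))) \<longlongrightarrow> (\<phi> p, \<phi> q)) (nhds 0)"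
    using isCont_tendsto_nhds[OF has_derivative_continuous[OF pair]] unfolding cd(1,2) .
  then have "\<forall>\<^sub>F t in nhds 0. (\<phi> (c t), \<phi> (d t)) \<in> mul_dom U"
    using topological_tendstoD[OF _ open_mul_dom[OF chart_openin[OF chart]] dom] by blast
  then have ev: "\<forall>\<^sub>F t in nhds 0. c t \<in> U \<and> d t \<in> U \<and> c t \<otimes> d t \<in> U"
    using cd(5,6) by eventually_elim (simp add: mul_dom_def pt_phi)
  then obtain S where S: "open S" "0 \<in> S" "\<And>t. t \<in> S \<Longrightarrow> c t \<in> U \<and> d t \<in> U \<and> c t \<otimes> d t \<in> U"
    unfolding eventually_nhds by blast
  have D: "(mul has_derivative (\<lambda>v. dir_deriv mul v (\<phi> p, \<phi> q))) (at (\<phi> (c 0), \<phi> (d 0)))"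
    using mul_has_derivative[OF U pq] cd(1,2) by simp
  have "((\<lambda>t. mul (\<phi> (c t), \<phi> (d t))) has_derivative (\<lambda>t. dir_deriv mul (t *\<^sub>R v, t *\<^sub>R w) (\<phi> p, \<phi> q))) (at 0)"
    by (rule has_derivative_compose[OF pair D])
  then have "((\<lambda>t. \<phi> (c t \<otimes> d t)) has_derivative (\<lambda>t. dir_deriv mul (t *\<^sub>R v, t *\<^sub>R w) (\<phi> p, \<phi> q))) (at 0)"
    by (rule has_derivative_transform_within_open[OF _ S(1,2)]) (simp add: S(3) mul_phi)
  moreover have "dir_deriv mul (t *\<^sub>R v, t *\<^sub>R w) (\<phi> p, \<phi> q) = t *\<^sub>R dir_deriv mul (v, w) (\<phi> p, \<phi> q)" for t
    using linear_scale[OF has_derivative_linear[OF D], of t "(v, w)"] by simp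
  ultimately have "((\<lambda>t. \<phi> (c t \<otimes> d t)) has_vector_derivative dir_deriv mul (v, w) (\<phi> p, \<phi> q)) (at 0)"
    by (simp add: has_vector_derivative_def)
  moreover have "\<forall>\<^sub>F t in nhds 0. c t \<otimes> d t \<in> U" using ev by eventually_elim simp
  ultimately show ?thesis
    using cd(1-4) by (auto simp: has_velocity_def image_subset_iff)
qed

lemma has_velocity_inv:
  assumes c: "has_velocity c p v" and p: "inv p \<in> U"
  obtains w where "has_velocity (\<lambda>t. inv (c t)) (inv p) w"
proof
  let ?i = "\<lambda>x. \<phi> (inv (pt x))"
  have cd: "c 0 = p" "range c \<subseteq> carrier G" "\<forall>\<^sub>F t in nhds 0. c t \<in> U"
    "((\<lambda>t. \<phi> (c t)) has_derivative (\<lambda>t. t *\<^sub>R v)) (at 0)"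
    using c by (simp_all add: has_velocity_def has_vector_derivative_def)
  note U = has_velocity_in_chart[OF c]
  have dom: "\<phi> p \<in> inv_dom" using U p by (simp add: inv_dom_def pt_phi)
  have "((\<lambda>t. \<phi> (c t)) \<longlongrightarrow> \<phi> p) (nhds 0)"
    using isCont_tendsto_nhds[OF has_derivative_continuous[OF cd(4)]] unfolding cd(1) .
  then have "\<forall>\<^sub>F t in nhds 0. \<phi> (c t) \<in> inv_dom"
    using topological_tendstoD[OF _ open_inv_dom dom] by blast
  then have ev: "\<forall>\<^sub>F t in nhds 0. c t \<in> U \<and> inv (c t) \<in> U"
    using cd(3) by eventually_elim (simp add: inv_dom_def pt_phi)
  then obtain S where S: "open S" "0 \<in> S" "\<And>t. t \<in> S \<Longrightarrow> c t \<in> U \<and> inv (c t) \<in> U"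
    unfolding eventually_nhds by blast
  have D: "(?i has_derivative (\<lambda>v. dir_deriv ?i v (\<phi> p))) (at (\<phi> (c 0)))"
    using smooth_on_has_derivative[OF smooth_inv dom] cd(1) by simp
  have "((\<lambda>t. ?i (\<phi> (c t))) has_derivative (\<lambda>t. dir_deriv ?i (t *\<^sub>R v) (\<phi> p))) (at 0)"
    by (rule has_derivative_compose[OF cd(4) D])
  then have "((\<lambda>t. \<phi> (inv (c t))) has_derivative (\<lambda>t. dir_deriv ?i (t *\<^sub>R v) (\<phi> p))) (at 0)"
    by (rule has_derivative_transform_within_open[OF _ S(1,2)]) (simp add: S(3) pt_phi)
  then have "((\<lambda>t. \<phi> (inv (c t))) has_vector_derivative dir_deriv ?i v (\<phi> p)) (at 0)"
    by (simp add: has_vector_derivative_def linear_scale[OF has_derivative_linear[OF D]])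
  moreover have "\<forall>\<^sub>F t in nhds 0. inv (c t) \<in> U" using ev by eventually_elim simp
  ultimately show "has_velocity (\<lambda>t. inv (c t)) (inv p) (dir_deriv ?i v (\<phi> p))"
    using cd(1,2) by (auto simp: has_velocity_def image_subset_iff)
qed

text \<open>For a closed subgroup this is its Lie algebra; the definition makes sense for every subgroup, and
  the terms of the lower central series need not be closed.\<close>

definition velocities :: "'g set \<Rightarrow> 'v set" where
  "velocities H = {v. \<exists>c. range c \<subseteq> H \<and> has_velocity c \<one> v}"

lemma subspace_velocities:
  assumes "subgroup H G"
  shows "subspace (velocities H)"
proof (rule subspaceI)
  show "0 \<in> velocities H"
    unfolding velocities_def using has_velocity_const[OF one_in] subgroup.one_closed[OF assms]
    by (auto intro!: exI[of _ "\<lambda>_. \<one>"])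
next
  fix v w assume "v \<in> velocities H" "w \<in> velocities H"
  then obtain c d where cd: "range c \<subseteq> H" "has_velocity c \<one> v" "range d \<subseteq> H" "has_velocity d \<one> w"
    unfolding velocities_def by blast
  have "has_velocity (\<lambda>t. c t \<otimes> d t) \<one> (v + w)"
    using has_velocity_mult[OF cd(2,4)] one_in by (simp add: dir_deriv_mul_one)
  moreover have "range (\<lambda>t. c t \<otimes> d t) \<subseteq> H"
    using cd subgroup.m_closed[OF assms] by (auto simp: image_subset_iff)
  ultimately show "v + w \<in> velocities H" unfolding velocities_def by blast
next
  fix r v assume "v \<in> velocities H"
  then obtain c where c: "range c \<subseteq> H" "has_velocity c \<one> v"
    unfolding velocities_def by blast
  then have "range (\<lambda>t. c (r * t)) \<subseteq> H" by auto
  then show "r *\<^sub>R v \<in> velocities H"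
    unfolding velocities_def using has_velocity_scale[OF c(2)] by blast
qed

lemma velocities_one: "velocities {\<one>} \<subseteq> {0}"
proof
  fix v assume "v \<in> velocities {\<one>}"
  then obtain c where c: "range c \<subseteq> {\<one>}" "has_velocity c \<one> v"
    unfolding velocities_def by blast
  then have "c = (\<lambda>_. \<one>)" by auto
  then show "v \<in> {0}" using c(2) has_velocity_const[OF one_in] has_velocity_unique by blast
qed

lemma velocities_carrier: "velocities (carrier G) = UNIV"
proof -
  have "v \<in> velocities (carrier G)" for v
  proof -
    define c where "c t = (if x0 + t *\<^sub>R v \<in> \<phi> ` U then pt (x0 + t *\<^sub>R v) else \<one>)" for t :: real
    have "((\<lambda>t. x0 + t *\<^sub>R v) \<longlongrightarrow> x0 + 0 *\<^sub>R v) (nhds 0)"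
      by (intro tendsto_add tendsto_scaleR tendsto_const filterlim_ident)
    then have "\<forall>\<^sub>F t in nhds 0. x0 + t *\<^sub>R v \<in> \<phi> ` U"
      using topological_tendstoD[OF _ chart_open_range[OF chart]] x0_in by simp
    then obtain S where S: "open S" "0 \<in> S" "\<And>t. t \<in> S \<Longrightarrow> x0 + t *\<^sub>R v \<in> \<phi> ` U"
      unfolding eventually_nhds by blast
    have "((\<lambda>t. x0 + t *\<^sub>R v) has_vector_derivative v) (at 0)"
      by (auto intro!: derivative_eq_intros)
    then have "((\<lambda>t. \<phi> (c t)) has_vector_derivative v) (at 0)"
      by (rule has_vector_derivative_transform_within_open[OF _ S(1,2)]) (simp add: c_def S(3) phi_pt)
    moreover have "c t \<in> U" for t using pt_in one_in by (simp add: c_def)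
    ultimately have "has_velocity c \<one> v"
      using chart_sub x0_in one_in by (auto simp: has_velocity_def c_def pt_phi)
    then show ?thesis unfolding velocities_def has_velocity_def by blast
  qed
  then show ?thesis by blast
qed

lemma right_field_linear:
  assumes "x \<in> \<phi> ` U"
  shows "linear (\<lambda>v. right_field v x)"
proof -
  have "(x0, x) \<in> mul_dom U" using in_mul_dom_one assms by blast
  from has_derivative_linear[OF smooth_on_has_derivative[OF smooth_mul this]]
  have L: "linear (\<lambda>z. dir_deriv mul z (x0, x))" .
  show ?thesis
    unfolding right_field_def
    using linear_add[OF L, of "(_, 0)" "(_, 0)"] linear_scale[OF L, of _ "(_, 0)"]
    by (intro linearI) simp_all
qed

text \<open>The velocity \<open>n\<close> of the commutator curve \<open>a c(t) a\<^sup>-\<^sup>1 c(t)\<^sup>-\<^sup>1\<close> is \<open>Ad(a) v - v\<close>, and the equation is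
  this one multiplied by \<open>a\<close> from the right. It is obtained from the identity that the
  commutator curve times \<open>c(t)\<close> times \<open>a\<close> is \<open>a c(t)\<close>, by differentiating both sides.\<close>

lemma commutator_velocity:
  assumes H: "H \<subseteq> carrier G" and a: "a \<in> U" "inv a \<in> U"
    and comm: "\<And>h. h \<in> H \<Longrightarrow> a \<otimes> h \<otimes> inv a \<otimes> inv h \<in> H'"
    and v: "v \<in> velocities H"
  obtains n where "n \<in> velocities H'" "right_field n (\<phi> a) = left_field v (\<phi> a) - right_field v (\<phi> a)"
proof -
  have aG: "a \<in> carrier G" using a chart_sub by blast
  obtain c where c: "range c \<subseteq> H" "has_velocity c \<one> v"
    using v unfolding velocities_def by blast
  have cG: "c t \<in> carrier G" for t using c(1) H by auto
  have ca: "has_velocity (\<lambda>t. a \<otimes> c t) a (left_field v (\<phi> a))"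
    using has_velocity_mult[OF has_velocity_const[OF a(1)] c(2)] a aG by (simp add: left_field_def)
  \<comment> \<open>The velocities \<open>i\<close> and \<open>k\<close> only serve to see that the commutator curve is differentiable at time \<open>0\<close>.\<close>
  obtain i where i: "has_velocity (\<lambda>t. inv (c t)) \<one> i"
    using has_velocity_inv[OF c(2)] one_in by auto
  obtain k where k: "has_velocity (\<lambda>t. a \<otimes> c t \<otimes> inv a) \<one> k"
    using has_velocity_mult[OF ca has_velocity_const[OF a(2)]] aG one_in by auto
  obtain n where n: "has_velocity (\<lambda>t. a \<otimes> c t \<otimes> inv a \<otimes> inv (c t)) \<one> n"
    using has_velocity_mult[OF k i] one_in by auto
  have "has_velocity (\<lambda>t. a \<otimes> c t \<otimes> inv a \<otimes> inv (c t) \<otimes> c t) \<one> (n + v)"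
    using has_velocity_mult[OF n c(2)] one_in by (simp add: dir_deriv_mul_one)
  from has_velocity_mult[OF this has_velocity_const[OF a(1)]]
  have "has_velocity (\<lambda>t. a \<otimes> c t \<otimes> inv a \<otimes> inv (c t) \<otimes> c t \<otimes> a) a (right_field (n + v) (\<phi> a))"
    using a aG by (simp add: right_field_def)
  moreover have "a \<otimes> c t \<otimes> inv a \<otimes> inv (c t) \<otimes> c t \<otimes> a = a \<otimes> c t" for t
    using aG cG by (simp add: m_assoc)
  ultimately have "right_field (n + v) (\<phi> a) = left_field v (\<phi> a)"
    using has_velocity_unique[OF ca] by simp
  then have "right_field n (\<phi> a) = left_field v (\<phi> a) - right_field v (\<phi> a)"
    using linear_add[OF right_field_linear, of "\<phi> a" n v] a by (simp add: eq_diff_eq)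
  moreover have "n \<in> velocities H'"
  proof -
    have "c t \<in> H" for t using c(1) by auto
    then have "range (\<lambda>t. a \<otimes> c t \<otimes> inv a \<otimes> inv (c t)) \<subseteq> H'" by (intro image_subsetI comm)
    then show ?thesis unfolding velocities_def using n by (intro CollectI exI conjI)
  qed
  ultimately show thesis by (rule that[rotated])
qed

text \<open>Take \<open>a\<close> with coordinates \<open>x s = x0 + s u\<close> in the previous lemma and divide by \<open>s\<close>. The right-hand
  side tends to the difference of the derivatives of a left-invariant and a right-invariant field,
  which is the bracket. The operator on the left-hand side tends to the identity, so the velocities
  \<open>n s / s\<close> converge to the bracket as well, and it remains in the closed subspace of velocities.\<close>

lemma bracket_velocity:
  assumes H: "H \<subseteq> carrier G" and H': "subgroup H' G"
    and comm: "\<And>a h. a \<in> carrier G \<Longrightarrow> h \<in> H \<Longrightarrow> a \<otimes> h \<otimes> inv a \<otimes> inv h \<in> H'"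
    and v: "v \<in> velocities H"
  shows "mixed_deriv u v - mixed_deriv v u \<in> velocities H'"
proof -
  define x where "x s = x0 + s *\<^sub>R u" for s :: real
  have x_deriv: "(x has_derivative (\<lambda>s. s *\<^sub>R u)) (at 0)"
    unfolding x_def by (auto intro!: derivative_eq_intros)
  have x_lim: "(x \<longlongrightarrow> x0) (at_right 0)"
  proof -
    have "(x \<longlongrightarrow> x0 + 0 *\<^sub>R u) (at_right 0)" unfolding x_def by (intro tendsto_intros)
    then show ?thesis by simp
  qed
  have "x0 \<in> inv_dom" using one_in by (simp add: inv_dom_def pt_phi)
  then have ev: "\<forall>\<^sub>F s in at_right 0. x s \<in> inv_dom"
    using topological_tendstoD[OF x_lim open_inv_dom] by blast
  have "\<exists>n. n \<in> velocities H' \<and> right_field n (x s) = left_field v (x s) - right_field v (x s)" if "x s \<in> inv_dom" for s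
  proof -
    have a: "pt (x s) \<in> U" "inv (pt (x s)) \<in> U" "\<phi> (pt (x s)) = x s"
      using that pt_in phi_pt by (auto simp: inv_dom_def)
    obtain n where "n \<in> velocities H'" "right_field n (\<phi> (pt (x s))) = left_field v (\<phi> (pt (x s))) - right_field v (\<phi> (pt (x s)))"
      using commutator_velocity[OF H a(1,2) comm v] a(1) chart_sub by blast
    then show ?thesis using a(3) by auto
  qed
  then obtain n where n: "\<And>s. x s \<in> inv_dom \<Longrightarrow> n s \<in> velocities H' \<and> right_field (n s) (x s) = left_field v (x s) - right_field v (x s)"
    by metis
  \<comment> \<open>Away from small \<open>s\<close>, where \<open>x s\<close> may leave the chart, \<open>k\<close> and \<open>T\<close> are set to \<open>0\<close> so that
    membership and linearity hold for all \<open>s\<close>.\<close>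
  define k where "k s = (if x s \<in> inv_dom then (1 / s) *\<^sub>R n s else 0)" for s
  define T where "T s w = (if x s \<in> inv_dom then right_field w (x s) else 0)" for s w
  have in_U: "x s \<in> \<phi> ` U" if "x s \<in> inv_dom" for s using that by (simp add: inv_dom_def)
  have sub: "subspace (velocities H')" by (rule subspace_velocities[OF H'])
  have k_in: "k s \<in> velocities H'" for s
    using n[of s] subspace_scale[OF sub] subspace_0[OF sub] by (simp add: k_def)
  have T_lin: "linear (T s)" for s
    using right_field_linear[OF in_U, of s] linear_zero
    by (cases "x s \<in> inv_dom") (simp_all add: T_def[abs_def])
  have T_lim: "((\<lambda>s. T s w) \<longlongrightarrow> w) (at_right 0)" for w
  proof -
    have "isCont (right_field w) x0" by (rule has_derivative_continuous[OF right_field_has_derivative])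
    from isCont_tendsto_compose[OF this x_lim]
    have "((\<lambda>s. right_field w (x s)) \<longlongrightarrow> w) (at_right 0)" by (simp add: right_field_one)
    then show ?thesis
      by (rule Lim_transform_eventually) (use ev in \<open>eventually_elim, simp add: T_def\<close>)
  qed
  have "((\<lambda>s. T s (k s)) \<longlongrightarrow> mixed_deriv u v - mixed_deriv v u) (at_right 0)"
  proof -
    let ?F = "\<lambda>s. left_field v (x s) - right_field v (x s)"
    have x00: "x 0 = x0" by (simp add: x_def)
    have "((\<lambda>s. left_field v (x s)) has_derivative (\<lambda>s. mixed_deriv (s *\<^sub>R u) v)) (at 0)"
      using has_derivative_compose[OF x_deriv left_field_has_derivative[folded x00]] .
    moreover have "((\<lambda>s. right_field v (x s)) has_derivative (\<lambda>s. mixed_deriv v (s *\<^sub>R u))) (at 0)"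
      using has_derivative_compose[OF x_deriv right_field_has_derivative[folded x00]] .
    ultimately have "(?F has_derivative (\<lambda>s. mixed_deriv (s *\<^sub>R u) v - mixed_deriv v (s *\<^sub>R u))) (at 0)"
      by (rule has_derivative_diff)
    moreover have "mixed_deriv (s *\<^sub>R u) v - mixed_deriv v (s *\<^sub>R u) = s *\<^sub>R (mixed_deriv u v - mixed_deriv v u)" for s
      using linear_scale[OF has_derivative_linear[OF left_field_has_derivative]]
        linear_scale[OF has_derivative_linear[OF right_field_has_derivative]] by (simp add: scaleR_diff_right)
    ultimately have "(?F has_derivative (\<lambda>s. s *\<^sub>R (mixed_deriv u v - mixed_deriv v u))) (at 0)"
      by simp
    then have "((\<lambda>s. (1 / \<bar>s\<bar>) *\<^sub>R (?F s - s *\<^sub>R (mixed_deriv u v - mixed_deriv v u))) \<longlongrightarrow> 0) (at 0)"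
      by (simp add: has_derivative_at2 x00 left_field_one right_field_one)
    then have "((\<lambda>s. (1 / \<bar>s\<bar>) *\<^sub>R (?F s - s *\<^sub>R (mixed_deriv u v - mixed_deriv v u))) \<longlongrightarrow> 0) (at_right 0)"
      by (rule tendsto_within_subset) simp
    then have "((\<lambda>s. (1 / \<bar>s\<bar>) *\<^sub>R (?F s - s *\<^sub>R (mixed_deriv u v - mixed_deriv v u)) + (mixed_deriv u v - mixed_deriv v u))
        \<longlongrightarrow> 0 + (mixed_deriv u v - mixed_deriv v u)) (at_right 0)"
      by (rule tendsto_add[OF _ tendsto_const])
    then have "((\<lambda>s. (1 / s) *\<^sub>R ?F s) \<longlongrightarrow> 0 + (mixed_deriv u v - mixed_deriv v u)) (at_right 0)"
    proof (rule Lim_transform_eventually)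
      show "\<forall>\<^sub>F s in at_right 0. (1 / \<bar>s\<bar>) *\<^sub>R (?F s - s *\<^sub>R (mixed_deriv u v - mixed_deriv v u)) + (mixed_deriv u v - mixed_deriv v u) = (1 / s) *\<^sub>R ?F s"
        using eventually_at_right_less[of "0::real"] by eventually_elim (simp add: scaleR_diff_right)
    qed
    then have "((\<lambda>s. (1 / s) *\<^sub>R ?F s) \<longlongrightarrow> mixed_deriv u v - mixed_deriv v u) (at_right 0)" by simp
    then show ?thesis
    proof (rule Lim_transform_eventually)
      show "\<forall>\<^sub>F s in at_right 0. (1 / s) *\<^sub>R ?F s = T s (k s)"
        using ev by eventually_elim (simp add: T_def k_def n linear_scale[OF right_field_linear[OF in_U]])
    qed
  qed
  from tendsto_of_near_identity[OF T_lin T_lim this]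
  have "(k \<longlongrightarrow> mixed_deriv u v - mixed_deriv v u) (at_right 0)" .
  moreover have "closed (velocities H')" by (rule closed_subspace[OF sub])
  ultimately show ?thesis
    using k_in by (intro Lim_in_closed_set[of "velocities H'" k "at_right 0"]) auto
qed

lemma lower_central_group_subgroup: "subgroup (lower_central_group G k) G"
proof (induction k)
  case 0
  then show ?case by (simp add: subgroup_self)
next
  case (Suc k)
  have "lower_central_group G k \<subseteq> carrier G" using subgroup.subset[OF Suc] .
  then show ?case
    unfolding lower_central_group.simps
    by (intro generate_is_subgroup) (auto simp: subset_iff)
qed

lemma lower_central_algebra_velocities:
  "lower_central_algebra X A G k \<subseteq> Vec ` velocities (lower_central_group G k)"
proof (induction k)
  case 0
  then show ?case by (simp add: velocities_carrier lie_algebra_eq_range_Vec)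
next
  case (Suc k)
  let ?H = "lower_central_group G k" and ?H' = "lower_central_group G (Suc k)"
  have comm: "a \<otimes> h \<otimes> inv a \<otimes> inv h \<in> ?H'" if "a \<in> carrier G" "h \<in> ?H" for a h
    unfolding lower_central_group.simps using that by (intro generate.incl) blast
  have "lie_bracket X A G x y \<in> Vec ` velocities ?H'"
    if xy: "x \<in> lie_algebra X A G" "y \<in> lower_central_algebra X A G k" for x y
  proof -
    obtain u v where "x = Vec u" "y = Vec v" "v \<in> velocities ?H"
      using xy Suc lie_algebra_eq_range_Vec by blast
    then show ?thesis
      using bracket_velocity[OF subgroup.subset[OF lower_central_group_subgroup] lower_central_group_subgroup comm]
      by (simp add: lie_bracket_Vec)
  qed
  moreover have "subspace (Vec ` velocities ?H')"
    by (rule linear_subspace_image[OF linear_Vec subspace_velocities[OF lower_central_group_subgroup]])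
  ultimately show ?case
    unfolding lower_central_algebra.simps by (intro span_minimal) auto
qed

lemma nilpotent_lie_algebra:
  assumes "nilpotent_lie_group X A G"
  obtains k where "lower_central_algebra X A G k \<subseteq> {0}"
proof (cases "\<exists>k. lower_central_group G k = {\<one>}")
  case True
  then obtain k where "lower_central_group G k = {\<one>}" by blast
  then have "lower_central_algebra X A G k \<subseteq> Vec ` {0}"
    using lower_central_algebra_velocities[of k] velocities_one by auto
  then show thesis using that linear_0[OF linear_Vec] by simp
next
  case False
  then show thesis using that assms unfolding nilpotent_lie_group_def by blast
qed

end


section \<open>The fundamental tensor as a second derivative\<close>

lemma minkowski_norm_square_smooth:
  assumes "minkowski_norm F"
  shows "smooth_on (- {0}) (\<lambda>z. (F z)\<^sup>2)"
  using assms smooth_on_mult[of "- {0}" F F]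
  by (simp add: minkowski_norm_def open_Compl power2_eq_square)

text \<open>The nested one-variable derivatives agree with the second derivative of \<open>F\<^sup>2\<close> because the lines
  \<open>y + s u\<close> avoid the origin for small \<open>s\<close>.\<close>

lemma fundamental_tensor_eq_second_deriv:
  fixes F :: "'v::euclidean_space \<Rightarrow> real"
  assumes F: "minkowski_norm F" and y: "y \<noteq> 0"
  shows "fundamental_tensor F y u v = dir_deriv (dir_deriv (\<lambda>z. (F z)\<^sup>2) v) u y / 2"
proof -
  let ?E = "\<lambda>z. (F z)\<^sup>2"
  have op: "open (- {0 :: 'v})" by (simp add: open_Compl)
  note s = minkowski_norm_square_smooth[OF F]
  have line: "deriv (\<lambda>t. f (z + t *\<^sub>R w)) 0 = dir_deriv f w z"
    if f: "smooth_on (- {0}) f" and z: "z \<noteq> 0" for f :: "'v \<Rightarrow> real" and z w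
  proof -
    have D: "(f has_derivative (\<lambda>w. dir_deriv f w z)) (at (z + 0 *\<^sub>R w))"
      using smooth_on_has_derivative[OF f, of z] z by simp
    have "((\<lambda>t. z + t *\<^sub>R w) has_derivative (\<lambda>t. t *\<^sub>R w)) (at 0)"
      by (auto intro!: derivative_eq_intros)
    from has_derivative_compose[OF this D]
    have "((\<lambda>t. f (z + t *\<^sub>R w)) has_derivative (\<lambda>t. dir_deriv f w z * t)) (at 0)"
      by (simp add: linear_scale[OF has_derivative_linear[OF D]] mult.commute)
    then show ?thesis
      by (intro DERIV_imp_deriv) (simp add: has_field_derivative_def)
  qed
  have "((\<lambda>s. y + s *\<^sub>R u) \<longlongrightarrow> y + 0 *\<^sub>R u) (nhds 0)"
    by (intro tendsto_add tendsto_scaleR tendsto_const filterlim_ident)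
  then have "\<forall>\<^sub>F s in nhds 0. y + s *\<^sub>R u \<in> - {0}"
    using topological_tendstoD[OF _ op] y by simp
  then have "\<forall>\<^sub>F s in nhds 0. deriv (\<lambda>t. ?E (y + s *\<^sub>R u + t *\<^sub>R v)) 0 = dir_deriv ?E v (y + s *\<^sub>R u)"
    by eventually_elim (rule line[OF s], simp)
  then have "deriv (\<lambda>s. deriv (\<lambda>t. ?E (y + s *\<^sub>R u + t *\<^sub>R v)) 0) 0 = deriv (\<lambda>s. dir_deriv ?E v (y + s *\<^sub>R u)) 0"
    by (rule deriv_cong_ev) simp
  also have "\<dots> = dir_deriv (dir_deriv ?E v) u y"
    by (rule line[OF smooth_on_dir_deriv[OF s] y])
  finally show ?thesis by (simp add: fundamental_tensor_def)
qed

lemma fundamental_tensor_linear: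
  fixes F :: "'v::euclidean_space \<Rightarrow> real"
  assumes F: "minkowski_norm F" and y: "y \<noteq> 0"
  shows "linear (\<lambda>u. fundamental_tensor F y u v)"
proof -
  from smooth_on_has_derivative[OF smooth_on_dir_deriv[OF minkowski_norm_square_smooth[OF F]], of y v]
  have "linear (\<lambda>u. dir_deriv (dir_deriv (\<lambda>z. (F z)\<^sup>2) v) u y)"
    using y by (intro has_derivative_linear) auto
  from linear_compose[OF this, of "\<lambda>r. r / 2"]
  show ?thesis
    unfolding fundamental_tensor_eq_second_deriv[OF F y] comp_def
    by (simp add: bounded_linear.linear[OF bounded_linear_divide])
qed

lemma fundamental_tensor_compose_linear:
  assumes "linear L"
  shows "fundamental_tensor F (L y) (L u) (L v) = fundamental_tensor (\<lambda>w. F (L w)) y u v"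
  by (simp add: fundamental_tensor_def linear_add[OF assms] linear_scale[OF assms])

lemma fundamental_tensor_zero_left: "fundamental_tensor F y 0 v = 0"
  by (simp add: fundamental_tensor_def)


section \<open>Central commutators and cyclic metrics\<close>

lemma lie_bracket_antisym: "lie_bracket X A G x y = - lie_bracket X A G y x"
  by (auto simp: lie_bracket_def field_bracket_def fun_eq_iff)

context lie_chart begin

lemma lie_bracket_closed:
  "x \<in> lie_algebra X A G \<Longrightarrow> y \<in> lie_algebra X A G \<Longrightarrow> lie_bracket X A G x y \<in> lie_algebra X A G"
  unfolding lie_algebra_eq_range_Vec using lie_bracket_Vec by auto

lemma subspace_lie_algebra: "subspace (lie_algebra X A G)"
  unfolding lie_algebra_eq_range_Vec by (rule linear_subspace_image[OF linear_Vec subspace_UNIV])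

lemma lower_central_algebra_subset: "lower_central_algebra X A G k \<subseteq> lie_algebra X A G"
proof (induction k)
  case (Suc k)
  then show ?case
    unfolding lower_central_algebra.simps
    by (intro span_minimal subspace_lie_algebra) (auto intro: lie_bracket_closed)
qed simp

text \<open>The vector \<open>y\<close> is taken from the last non-zero term of the lower central series. Since the algebra
  is not abelian, this is not the whole algebra but a term consisting of brackets.\<close>

lemma nilpotent_central_commutator:
  assumes "nilpotent_lie_group X A G" and nonab: "nonabelian_lie_algebra X A G"
  obtains y where "y \<noteq> 0" "y \<in> lie_algebra X A G" "y \<in> lower_central_algebra X A G 1"
    "\<And>x. x \<in> lie_algebra X A G \<Longrightarrow> lie_bracket X A G x y = 0"
proof -
  define N where "N = (LEAST k. lower_central_algebra X A G k \<subseteq> {0})"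
  obtain k where "lower_central_algebra X A G k \<subseteq> {0}"
    using nilpotent_lie_algebra[OF assms(1)] .
  then have N: "lower_central_algebra X A G N \<subseteq> {0}"
    unfolding N_def by (rule LeastI)
  have least: "\<not> lower_central_algebra X A G j \<subseteq> {0}" if "j < N" for j
    using that not_less_Least unfolding N_def by blast
  obtain a b where ab: "a \<in> lie_algebra X A G" "b \<in> lie_algebra X A G" "lie_bracket X A G a b \<noteq> 0"
    using nonab unfolding nonabelian_lie_algebra_def by blast
  have br: "lie_bracket X A G x y \<in> lower_central_algebra X A G (Suc k)"
    if "x \<in> lie_algebra X A G" "y \<in> lower_central_algebra X A G k" for x y k
    unfolding lower_central_algebra.simps using that by (intro span_base) blast
  have "lie_bracket X A G a b \<in> lower_central_algebra X A G 0"
    using lie_bracket_closed[OF ab(1,2)] by simp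
  then have "N \<noteq> 0" using N ab(3) by (metis singletonD subsetD)
  moreover have "lie_bracket X A G a b \<in> lower_central_algebra X A G 1"
    using br[of a b 0] ab by simp
  then have "N \<noteq> 1" using N ab(3) by (metis singletonD subsetD)
  ultimately obtain j where j: "N = Suc (Suc j)"
    by (metis One_nat_def not0_implies_Suc)
  have mono: "lower_central_algebra X A G (Suc j) \<subseteq> lower_central_algebra X A G 1"
    using lower_central_algebra_subset[of j] by (auto intro!: span_mono)
  have "\<not> lower_central_algebra X A G (Suc j) \<subseteq> {0}" by (rule least) (simp add: j)
  then obtain y where y: "y \<in> lower_central_algebra X A G (Suc j)" "y \<noteq> 0"
    by (metis singletonI subsetI)
  show thesis
  proof (rule that[OF y(2)])
    show "lie_bracket X A G x y = 0" if "x \<in> lie_algebra X A G" for x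
      using br[OF that y(1)] N unfolding j by (metis singletonD subsetD)
  qed (use y(1) mono lower_central_algebra_subset in blast)+
qed

lemma no_cyclic_metric:
  assumes nil: "nilpotent_lie_group X A G" and nonab: "nonabelian_lie_algebra X A G"
    and F: "finsler_metric X A F" and cyc: "cyclic_metric X A G F"
  shows False
proof -
  let ?F = "\<lambda>w. F \<one> (Vec w)" and ?T = "fundamental_tensor (F \<one>)"
  have mink: "minkowski_norm ?F"
    using F chart one_in unfolding finsler_metric_def Vec_def Let_def by fast
  obtain y where y: "y \<noteq> 0" "y \<in> lie_algebra X A G" "y \<in> lower_central_algebra X A G 1"
    and central: "\<And>x. x \<in> lie_algebra X A G \<Longrightarrow> lie_bracket X A G x y = 0"
    using nilpotent_central_commutator[OF nil nonab] by blast
  obtain w where w: "y = Vec w" using y(2) lie_algebra_eq_range_Vec by auto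
  have "w \<noteq> 0" using y(1) w linear_0[OF linear_Vec] by auto
  define S where "S = {u. fundamental_tensor ?F w u w = 0}"
  have "linear (\<lambda>u. fundamental_tensor ?F w u w)"
    by (rule fundamental_tensor_linear[OF mink \<open>w \<noteq> 0\<close>])
  then have "subspace S"
    unfolding S_def by (rule linear_subspace_kernel)
  then have sub: "subspace (Vec ` S)" by (rule linear_subspace_image[OF linear_Vec])
  have bracket_in: "lie_bracket X A G z x \<in> Vec ` S"
    if x: "x \<in> lie_algebra X A G" and z: "z \<in> lie_algebra X A G" for x z
  proof -
    have "?T y (lie_bracket X A G x y) z + ?T y (lie_bracket X A G y z) x + ?T y (lie_bracket X A G z x) y = 0"
      using cyc x z y unfolding cyclic_metric_def by blast
    moreover have "lie_bracket X A G y z = 0"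
      using lie_bracket_antisym[of X A G y z] central[OF z] by simp
    ultimately have "?T y (lie_bracket X A G z x) y = 0"
      by (simp add: central[OF x] fundamental_tensor_zero_left)
    moreover obtain u where "lie_bracket X A G z x = Vec u"
      using lie_bracket_closed[OF z x] lie_algebra_eq_range_Vec by auto
    ultimately show ?thesis
      unfolding S_def w by (auto simp: fundamental_tensor_compose_linear[OF linear_Vec])
  qed
  have "lower_central_algebra X A G 1 \<subseteq> Vec ` S"
    unfolding One_nat_def lower_central_algebra.simps
    by (rule span_minimal[OF _ sub]) (use bracket_in in blast)
  then have "Vec w \<in> Vec ` S" using y(3) w by blast
  then obtain u where "u \<in> S" and eq: "Vec u = Vec w" by (metis imageE)
  then have u: "fundamental_tensor ?F w u w = 0" by (simp add: S_def)
  \<comment> \<open>The tensor depends on \<open>u\<close> through the tangent vector \<open>Vec u\<close> only, and this is \<open>y\<close>.\<close>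
  have "fundamental_tensor ?F w w w = fundamental_tensor ?F w u w"
    unfolding fundamental_tensor_compose_linear[OF linear_Vec, symmetric] eq ..
  moreover have "fundamental_tensor ?F w w w > 0"
    using mink \<open>w \<noteq> 0\<close> by (simp add: minkowski_norm_def)
  ultimately show False using u by simp
qed

end

theorem theorem1p2:
  fixes X :: "'g topology" and A :: "('g, 'v::euclidean_space) chart set" and G :: "'g monoid"
  assumes "lie_group X A G"
    and "nilpotent_lie_group X A G"
    and "nonabelian_lie_algebra X A G"
  shows "\<not> (\<exists>F. finsler_metric X A F \<and> left_invariant_metric X A G F \<and> cyclic_metric X A G F)"
proof -
  have G: "group G" and mfd: "smooth_manifold X A" and top: "topspace X = carrier G"
    using assms(1) unfolding lie_group_def by blast+
  interpret group G by (rule G)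
  have "\<one>\<^bsub>G\<^esub> \<in> (\<Union>(U, \<phi>)\<in>A. U)"
    using mfd top unfolding smooth_manifold_def by simp
  then obtain U \<phi> where "(U, \<phi>) \<in> A" "\<one>\<^bsub>G\<^esub> \<in> U" by auto
  then interpret lie_chart X A G U \<phi>
    using assms(1) mfd by unfold_locales
  show ?thesis using no_cyclic_metric[OF assms(2,3)] by blast
qed

end
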